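(* Let $\alpha_1,\alpha_2\in\mathbb{R}$ and $0<p_1,p_2,q_1,q_2\le\infty$ be such that $$2\alpha_1+\tfrac32d<(d+1)\Big(\alpha_2-\frac{d}{p_2(d+1)}+\frac12\Big)+\frac12+\frac{d}{p_1}.$$ Then there exists a sequence of functions $\{f^{(j)}\}_{j\in\mathbb{N}}$ in $\mathbf{B}^{\alpha_2,q_2}_{p_2}(AB)$ with $\|f^{(j)}\|_{\mathbf{B}^{\alpha_2,q_2}_{p_2}(AB)}\approx1$ for all $j\in\mathbb{N}$ (i.e. bounded above and below by positive constants independent of $j$), but $\lim_{j\to\infty}\|f^{(j)}\|_{\mathbf{B}^{\alpha_1,q_1}_{p_1}}=0$.
   Context: Let $d\ge2$. Frequency vectors $\xi\in\hat{\mathbb{R}}^d$ are row vectors, and $\hat g(\xi)=\int_{\mathbb{R}^d}g(x)e^{-2\pi i\xi x}dx$. $\mathcal{S}$, $\mathcal{S}'$ are the Schwartz class and tempered distributions on $\mathbb{R}^d$. Classical (dyadic isotropic) inhomogeneous Besov space. Let $\varphi,\Phi\in\mathcal{S}$ with $\operatorname{supp}\hat\varphi\subseteq\{\frac12\le|\xi|\le2\}$, $\operatorname{supp}\hat\Phi\subseteq\{|\xi|\le2\}$, $|\hat\varphi(\xi)|\ge c>0$ for $\frac35\le|\xi|\le\frac53$, $|\hat\Phi(\xi)|\ge c>0$ for $|\xi|\le\frac53$; $\varphi_{2^\nu I}(x)=2^{d\nu}\varphi(2^\nu x)$. $\mathbf{B}^{\alpha,q}_p$ is the set of $f\in\mathcal{S}'$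 with $\|f\|_{\mathbf{B}^{\alpha,q}_p}=\|\Phi*f\|_{L^p}+\big(\sum_{\nu=0}^\infty(2^{\nu\alpha}\|\varphi_{2^\nu I}*f\|_{L^p})^q\big)^{1/q}<\infty$. Shearlets. Fix $\hat\psi_1,\hat\psi_2\in C^\infty(\mathbb{R})$ with $\operatorname{supp}\hat\psi_1\subset[-\frac12,-\frac1{16}]\cup[\frac1{16},\frac12]$, $\operatorname{supp}\hat\psi_2\subset[-1,1]$, $\sum_{j\ge0}|\hat\psi_1(2^{-2j}\omega)|^2=1$ for $|\omega|\ge\frac18$, and $|\hat\psi_2(\omega-1)|^2+|\hat\psi_2(\omega)|^2+|\hat\psi_2(\omega+1)|^2=1$ for $|\omega|\le1$. For $\mathfrak d=1,\dots,d$ let $\hat\psi^{(\mathfrak d)}(\xi)=\hat\psi_1(\xi_{\mathfrak d})\prod_{i\ne\mathfrak d}\hat\psi_2(\xi_i/\xi_{\mathfrak d})$. Let $A_{(\mathfrak d)}$ be the diagonal $d\times d$ matrix with entry $4$ in position $\mathfrak d$ and $2$ elsewhere. For $\ell\in\mathbb{Z}^{d-1}$ let $B^{[\ell]}_{(\mathfrak d)}$ be the identity matrix with the off-diagonal entries of row $\mathfrak d$ replaced, in order, by $\ell_1,\dots,\ell_{d-1}$; its inverse is $B^{[-\ell]}_{(\mathfrak d)}$. Write $|[\ell]|\preceq2^j$ if $|\ell_i|\le2^j$ for all $i$. For an invertible matrix $M$, $\psi_M(x)=|\det M|^{-1}\psi(M^{-1}x)$. Let $\hat\Psi\in C_c^\infty(\hat{\mathbb{R}}^d)$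 with $\operatorname{supp}\hat\Psi\subset[-\frac14,\frac14]^d$ and $|\hat\Psi|=1$ on $\mathcal R=[-\frac18,\frac18]^d$ be such that for all $\xi$ $$|\hat\Psi(\xi)|^2\chi_{\mathcal R}(\xi)+\sum_{\mathfrak d=1}^d\sum_{j\ge0}\sum_{|[\ell]|\preceq2^j}|\hat\psi^{(\mathfrak d)}(\xi A^{-j}_{(\mathfrak d)}B^{[-\ell]}_{(\mathfrak d)})|^2\chi_{\mathcal D^{(\mathfrak d)}}(\xi)=1,$$ where $\mathcal D^{(\mathfrak d)}=\{\xi:|\xi_{\mathfrak d}|\ge\frac18,\ |\xi_i/\xi_{\mathfrak d}|\le1\ (i\ne\mathfrak d)\}$. Put $|Q_j|=2^{-(d+1)j}$. Shear anisotropic inhomogeneous Besov space. $\mathbf{B}^{\alpha,q}_p(AB)$ is the set of $f\in\mathcal{S}'$ with $$\|f\|_{\mathbf{B}^{\alpha,q}_p(AB)}=\|f*\Psi\|_{L^p}+\Big(\sum_{\mathfrak d=1}^d\sum_{j\ge0}\sum_{|[\ell]|\preceq2^j}\big[|Q_j|^{-\alpha}\|f*\psi^{(\mathfrak d)}_{A^{-j}_{(\mathfrak d)}B^{[-\ell]}_{(\mathfrak d)}}\|_{L^p}\big]^q\Big)^{1/q}<\infty$$ (supremum when $q=\infty$).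
   Formalization: The identity for Ψ and the shearlets is required only for almost every ξ: required for all ξ it contradicts the other conditions, since the closed cones D overlap on their boundaries (for d=2, ξ=(1,1) the sum is 2). *)

theory Defs
  imports "HOL-Analysis.Analysis" "HOL-Probability.Essential_Supremum"
begin

section \<open>Smooth functions, Schwartz functions, tempered distributions\<close>

text \<open>
  \<open>iter_deriv [b1, ..., bm] f\<close> is the mixed partial derivative of \<open>f\<close> in the coordinate
  directions \<open>b1, ..., bm \<in> Basis\<close>.  Demanding that all of these be (Frechet) differentiable
  everywhere makes each of them continuous and is therefore the class \<open>C\<^sup>\<infinity>\<close>.
\<close>

primrec iter_deriv :: "'a::euclidean_space list \<Rightarrow> ('a \<Rightarrow> complex) \<Rightarrow> 'a \<Rightarrow> complex" where
  "iter_deriv [] f = f"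
| "iter_deriv (b # bs) f = (\<lambda>x. frechet_derivative (iter_deriv bs f) (at x) b)"

definition smooth :: "('a::euclidean_space \<Rightarrow> complex) \<Rightarrow> bool" where
  "smooth f \<longleftrightarrow>
     (\<forall>bs. set bs \<subseteq> Basis \<longrightarrow> (\<forall>x. iter_deriv bs f differentiable at x))"

definition schwartz :: "('a::euclidean_space \<Rightarrow> complex) \<Rightarrow> bool" where
  "schwartz f \<longleftrightarrow> smooth f \<and>
     (\<forall>k bs. set bs \<subseteq> Basis \<longrightarrow>
        bdd_above (range (\<lambda>x. (1 + norm x) ^ k * norm (iter_deriv bs f x))))"

definition schwartz_norm :: "nat \<Rightarrow> ('a::euclidean_space \<Rightarrow> complex) \<Rightarrow> real" where
  "schwartz_norm N f =
     (SUP (bs, x) \<in> {bs. set bs \<subseteq> Basis \<and> length bs \<le> N} \<times> UNIV.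
        (1 + norm x) ^ N * norm (iter_deriv bs f x))"

text \<open>
  A tempered distribution is a functional on the type of all functions of which only the
  values on Schwartz functions matter: there it is linear, and continuous for the topology
  given by the increasing family of norms \<^const>\<open>schwartz_norm\<close>.
\<close>

definition tempered_distribution ::
    "(('a::euclidean_space \<Rightarrow> complex) \<Rightarrow> complex) \<Rightarrow> bool" where
  "tempered_distribution u \<longleftrightarrow>
     (\<forall>f g. schwartz f \<longrightarrow> schwartz g \<longrightarrow> u (\<lambda>x. f x + g x) = u f + u g) \<and>
     (\<forall>c f. schwartz f \<longrightarrow> u (\<lambda>x. c * f x) = c * u f) \<and>
     (\<exists>C N. \<forall>f. schwartz f \<longrightarrow> norm (u f) \<le> C * schwartz_norm N f)"

text \<open>
  The distribution induced by a function.  The integral is meaningful only under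
  \<open>tempered_function\<close>, as the Bochner integral of a non-integrable function is 0.
\<close>

definition tempered_function :: "('a::euclidean_space \<Rightarrow> complex) \<Rightarrow> bool" where
  "tempered_function f \<longleftrightarrow> (\<forall>g. schwartz g \<longrightarrow> integrable lborel (\<lambda>x. f x * g x))"

definition distr_of ::
    "('a::euclidean_space \<Rightarrow> complex) \<Rightarrow> ('a \<Rightarrow> complex) \<Rightarrow> complex" where
  "distr_of f g = (LINT x|lborel. f x * g x)"

definition conv_distr ::
    "(('a::euclidean_space \<Rightarrow> complex) \<Rightarrow> complex) \<Rightarrow> ('a \<Rightarrow> complex) \<Rightarrow> 'a \<Rightarrow> complex" where
  "conv_distr u g x = u (\<lambda>y. g (x - y))"

definition fourier :: "('a::euclidean_space \<Rightarrow> complex) \<Rightarrow> 'a \<Rightarrow> complex" where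
  "fourier g \<xi> =
     (LINT x|lborel. g x * exp (- 2 * of_real pi * \<i> * of_real (\<xi> \<bullet> x)))"

definition supp :: "('a::euclidean_space \<Rightarrow> complex) \<Rightarrow> 'a set" where
  "supp f = closure {x. f x \<noteq> 0}"


section \<open>Quasi-norms with values in the extended nonnegative reals\<close>

text \<open>Only used with exponent \<open>r > 0\<close>, where \<open>0\<close> and \<open>\<infinity>\<close> are fixed points.\<close>

definition enn_powr :: "ennreal \<Rightarrow> real \<Rightarrow> ennreal" where
  "enn_powr x r = (if x = \<infinity> then \<infinity> else ennreal (enn2real x powr r))"

definition Lp_norm :: "ennreal \<Rightarrow> ('a::euclidean_space \<Rightarrow> complex) \<Rightarrow> ennreal" where
  "Lp_norm p g =
     (if p = \<infinity> then esssup lborel (\<lambda>x. ennreal (norm (g x)))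
      else enn_powr (\<integral>\<^sup>+ x. ennreal (norm (g x) powr enn2real p) \<partial>lborel) (1 / enn2real p))"


section \<open>The classical inhomogeneous Besov quasi-norm\<close>

definition dyadic_generators ::
    "(real^'n \<Rightarrow> complex) \<Rightarrow> (real^'n \<Rightarrow> complex) \<Rightarrow> bool" where
  "dyadic_generators \<Phi> \<phi> \<longleftrightarrow>
     schwartz \<Phi> \<and> schwartz \<phi> \<and>
     supp (fourier \<phi>) \<subseteq> {\<xi>. 1 / 2 \<le> norm \<xi> \<and> norm \<xi> \<le> 2} \<and>
     supp (fourier \<Phi>) \<subseteq> {\<xi>. norm \<xi> \<le> 2} \<and>
     (\<exists>c>0. \<forall>\<xi>. 3 / 5 \<le> norm \<xi> \<and> norm \<xi> \<le> 5 / 3 \<longrightarrow> norm (fourier \<phi> \<xi>) \<ge> c) \<and>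
     (\<exists>c>0. \<forall>\<xi>. norm \<xi> \<le> 5 / 3 \<longrightarrow> norm (fourier \<Phi> \<xi>) \<ge> c)"

definition dyadic_dilate :: "nat \<Rightarrow> (real^'n \<Rightarrow> complex) \<Rightarrow> real^'n \<Rightarrow> complex" where
  "dyadic_dilate \<nu> \<phi> x = 2 ^ (CARD('n) * \<nu>) * \<phi> (2 ^ \<nu> *\<^sub>R x)"

definition besov_norm ::
    "(real^'n \<Rightarrow> complex) \<Rightarrow> (real^'n \<Rightarrow> complex) \<Rightarrow> real \<Rightarrow> ennreal \<Rightarrow> ennreal \<Rightarrow>
     ((real^'n \<Rightarrow> complex) \<Rightarrow> complex) \<Rightarrow> ennreal" where
  "besov_norm \<Phi> \<phi> \<alpha> p q u =
     (let a = (\<lambda>\<nu>::nat. ennreal (2 powr (real \<nu> * \<alpha>))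
                          * Lp_norm p (conv_distr u (dyadic_dilate \<nu> \<phi>)))
      in Lp_norm p (conv_distr u \<Phi>) +
         (if q = \<infinity> then (SUP \<nu>. a \<nu>)
          else enn_powr (\<Sum>\<nu>. enn_powr (a \<nu>) (enn2real q)) (1 / enn2real q)))"


section \<open>Shearlets\<close>

primrec mat_pow :: "real^'n^'n \<Rightarrow> nat \<Rightarrow> real^'n^'n" where
  "mat_pow M 0 = mat 1"
| "mat_pow M (Suc j) = M ** mat_pow M j"

definition A_mat :: "'n \<Rightarrow> real^'n^'n" where
  "A_mat \<dd> = (\<chi> i k. if i = k then (if i = \<dd> then 4 else 2) else 0)"

text \<open>
  A shear parameter \<open>l \<in> \<int>\<^sup>d\<^sup>-\<^sup>1\<close> for the direction \<open>\<dd>\<close> is indexed by the coordinates other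
  than \<open>\<dd>\<close>: it is an integer vector \<open>l\<close> with \<open>l $ \<dd> = 0\<close>.
\<close>

definition B_mat :: "'n \<Rightarrow> int^'n \<Rightarrow> real^'n^'n" where
  "B_mat \<dd> l = (\<chi> i k. if i = k then 1 else if i = \<dd> then real_of_int (l $ k) else 0)"

definition shears :: "'n \<Rightarrow> nat \<Rightarrow> (int^'n) set" where
  "shears \<dd> j = {l. l $ \<dd> = 0 \<and> (\<forall>i. i \<noteq> \<dd> \<longrightarrow> \<bar>l $ i\<bar> \<le> 2 ^ j)}"

definition shear_mat :: "'n \<Rightarrow> nat \<Rightarrow> int^'n \<Rightarrow> real^'n^'n" where
  "shear_mat \<dd> j l = matrix_inv (mat_pow (A_mat \<dd>) j) ** B_mat \<dd> (- l)"

definition mat_dilate :: "real^'n^'n \<Rightarrow> (real^'n \<Rightarrow> complex) \<Rightarrow> real^'n \<Rightarrow> complex" where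
  "mat_dilate M \<psi> x = of_real (inverse \<bar>det M\<bar>) * \<psi> (matrix_inv M *v x)"

definition R_box :: "(real^'n) set" where
  "R_box = {\<xi>. \<forall>i. \<bar>\<xi> $ i\<bar> \<le> 1 / 8}"

definition D_cone :: "'n \<Rightarrow> (real^'n) set" where
  "D_cone \<dd> = {\<xi>. \<bar>\<xi> $ \<dd>\<bar> \<ge> 1 / 8 \<and> (\<forall>i. i \<noteq> \<dd> \<longrightarrow> \<bar>\<xi> $ i / \<xi> $ \<dd>\<bar> \<le> 1)}"

text \<open>
  \<open>h1\<close> and \<open>h2\<close> are the one-dimensional functions \<open>\<psi>\<^sub>1\<close>, \<open>\<psi>\<^sub>2\<close> on the Fourier side.
\<close>

definition shearlet_profiles :: "(real \<Rightarrow> complex) \<Rightarrow> (real \<Rightarrow> complex) \<Rightarrow> bool" where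
  "shearlet_profiles h1 h2 \<longleftrightarrow>
     smooth h1 \<and> smooth h2 \<and>
     supp h1 \<subseteq> {- 1 / 2 .. - 1 / 16} \<union> {1 / 16 .. 1 / 2} \<and>
     supp h2 \<subseteq> {- 1 .. 1} \<and>
     (\<forall>\<omega>. \<bar>\<omega>\<bar> \<ge> 1 / 8 \<longrightarrow> (\<lambda>j. (norm (h1 (\<omega> / 2 ^ (2 * j))))\<^sup>2) sums 1) \<and>
     (\<forall>\<omega>. \<bar>\<omega>\<bar> \<le> 1 \<longrightarrow>
        (norm (h2 (\<omega> - 1)))\<^sup>2 + (norm (h2 \<omega>))\<^sup>2 + (norm (h2 (\<omega> + 1)))\<^sup>2 = 1)"

definition shearlet_hat ::
    "(real \<Rightarrow> complex) \<Rightarrow> (real \<Rightarrow> complex) \<Rightarrow> 'n::finite \<Rightarrow> real^'n \<Rightarrow> complex" where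
  "shearlet_hat h1 h2 \<dd> \<xi> = h1 (\<xi> $ \<dd>) * (\<Prod>i\<in>UNIV - {\<dd>}. h2 (\<xi> $ i / \<xi> $ \<dd>))"

text \<open>
  The generators \<open>\<Psi>\<close> and \<open>\<psi> \<dd>\<close> are the Schwartz functions with the prescribed Fourier
  transforms.  The tiling identity is required almost everywhere: the box and the cones are
  closed, so that on their common boundaries (a null set) two or more summands equal 1 and the
  pointwise identity cannot hold there.
\<close>

definition shearlet_system ::
    "(real \<Rightarrow> complex) \<Rightarrow> (real \<Rightarrow> complex) \<Rightarrow> (real^'n \<Rightarrow> complex) \<Rightarrow>
     ('n \<Rightarrow> real^'n \<Rightarrow> complex) \<Rightarrow> bool" where
  "shearlet_system h1 h2 \<Psi> \<psi> \<longleftrightarrow>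
     shearlet_profiles h1 h2 \<and>
     (\<forall>\<dd>. schwartz (\<psi> \<dd>) \<and> fourier (\<psi> \<dd>) = shearlet_hat h1 h2 \<dd>) \<and>
     schwartz \<Psi> \<and> smooth (fourier \<Psi>) \<and>
     supp (fourier \<Psi>) \<subseteq> {\<xi>. \<forall>i. \<bar>\<xi> $ i\<bar> \<le> 1 / 4} \<and>
     (\<forall>\<xi>\<in>R_box. norm (fourier \<Psi> \<xi>) = 1) \<and>
     (AE \<xi> in lborel.
        ennreal ((norm (fourier \<Psi> \<xi>))\<^sup>2 * indicator R_box \<xi>) +
        (\<Sum>\<dd>\<in>UNIV. \<Sum>j. \<Sum>l\<in>shears \<dd> j.
           ennreal ((norm (shearlet_hat h1 h2 \<dd> (\<xi> v* shear_mat \<dd> j l)))\<^sup>2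
                    * indicator (D_cone \<dd>) \<xi>)) = 1)"


section \<open>The shear anisotropic inhomogeneous Besov space\<close>

definition Q_vol :: "nat \<Rightarrow> nat \<Rightarrow> real" where
  "Q_vol d j = 2 powr (- (real (d + 1) * real j))"

definition shear_besov_norm ::
    "(real^'n \<Rightarrow> complex) \<Rightarrow> ('n \<Rightarrow> real^'n \<Rightarrow> complex) \<Rightarrow> real \<Rightarrow> ennreal \<Rightarrow> ennreal \<Rightarrow>
     ((real^'n \<Rightarrow> complex) \<Rightarrow> complex) \<Rightarrow> ennreal" where
  "shear_besov_norm \<Psi> \<psi> \<alpha> p q u =
     (let a = (\<lambda>\<dd> j l. ennreal (Q_vol CARD('n) j powr (- \<alpha>))
                          * Lp_norm p (conv_distr u (mat_dilate (shear_mat \<dd> j l) (\<psi> \<dd>))))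
      in Lp_norm p (conv_distr u \<Psi>) +
         (if q = \<infinity> then (SUP \<dd>. SUP j. SUP l\<in>shears \<dd> j. a \<dd> j l)
          else enn_powr (\<Sum>\<dd>\<in>UNIV. \<Sum>j. \<Sum>l\<in>shears \<dd> j. enn_powr (a \<dd> j l) (enn2real q))
                 (1 / enn2real q)))"

definition shear_besov_space ::
    "(real^'n \<Rightarrow> complex) \<Rightarrow> ('n \<Rightarrow> real^'n \<Rightarrow> complex) \<Rightarrow> real \<Rightarrow> ennreal \<Rightarrow> ennreal \<Rightarrow>
     ((real^'n \<Rightarrow> complex) \<Rightarrow> complex) set" where
  "shear_besov_space \<Psi> \<psi> \<alpha> p q =
     {u. tempered_distribution u \<and> shear_besov_norm \<Psi> \<psi> \<alpha> p q u < \<infinity>}"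

end

theory Submission
  imports Defs "HOL-Probability.Probability_Measure"
begin

text \<open>
  The sequence consists of modulated isotropic bumps of spatial width \<open>2\<^sup>-\<^sup>j\<close> at the frequency
  \<open>4\<^sup>j a\<close> on a coordinate axis.  Its spectrum is so small that, uniformly in \<open>j\<close>, it only meets
  boundedly many shearlets (of scales within 2 of \<open>j\<close>, and shears of size at most 2) and
  boundedly many dyadic annuli (of scales near \<open>2 j\<close>).  Each convolution is again essentially
  such a bump, so all \<open>L\<^sup>p\<close> quasi-norms scale like \<open>2\<close> to the power \<open>- j d / p\<close>.  Normalising the
  shear quasi-norm to 1, the classical one is of order \<open>2\<close> to the power
  \<open>j (2 \<alpha>\<^sub>1 - (d + 1) \<alpha>\<^sub>2 + d / p\<^sub>2 - d / p\<^sub>1)\<close>, whose exponent the hypothesis makes negative.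
  Since only finitely much decay is needed, the bump is a power of a product of sinc functions,
  which makes its Fourier support compact without Fourier inversion.
\<close>

section \<open>Band-limited functions\<close>

text \<open>The exponents may lie below 1, where the L^p triangle inequality and Young's inequality
  fail. Every L^p estimate therefore comes from a pointwise one: an upper bound
  \<open>B / (1 + \<mu> * norm x) ^ m\<close> with m > d/p, or a lower bound on a ball of radius
  comparable to 1/\<mu>. Both produce the same power \<mu>^(-d/p), so the two sides match. The width
  2^-j is dictated by the shearlet tiles. At scale j a tile is about 4^j long along its axis but
  only about 2^j wide across it, so a ball of radius comparable to 2^j is, up to a constant, the
  largest isotropic spectrum that meets boundedly many tiles. In the dyadic system the frequency 4^j
  = 2^(2j) has index 2j, hence the weight 2^(2j \<alpha>1) against |Q_j|^(-\<alpha>2) = 2^((d+1) j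
  \<alpha>2). The profiles are known only through supports and square-sum identities, so the point a
  and the tile used for the lower bound have to be extracted from those identities. Uniformity in j
  is obtained by stating the estimates for arbitrary dilation matrices, with constants fixed before
  matrix, centre, width and amplitude.\<close>

definition wave :: "'a::euclidean_space \<Rightarrow> 'a \<Rightarrow> complex" where
  "wave \<xi> x = cis (2 * pi * (\<xi> \<bullet> x))"

lemma norm_wave [simp]: "norm (wave \<xi> x) = 1"
  by (simp add: wave_def)

lemma wave_add_left: "wave (\<xi> + \<eta>) x = wave \<xi> x * wave \<eta> x"
  by (simp add: wave_def cis_mult inner_add_left algebra_simps)

lemma wave_diff_right: "wave \<xi> (x - y) = wave \<xi> x * wave (- \<xi>) y"
  by (simp add: wave_def cis_mult inner_diff_right algebra_simps)

lemma measurable_cis [measurable (raw)]: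
  "f \<in> borel_measurable M \<Longrightarrow> (\<lambda>z. cis (f z)) \<in> borel_measurable M"
  by (rule measurable_compose[OF _ borel_measurable_continuous_onI[of cis]])
     (auto intro: continuous_on_cis continuous_on_id)

lemma measurable_wave [measurable (raw)]:
  "f \<in> borel_measurable M \<Longrightarrow> g \<in> borel_measurable M \<Longrightarrow> (\<lambda>z. wave (f z) (g z)) \<in> borel_measurable M"
  unfolding wave_def by measurable

lemma norm_cis_diff_le: "norm (cis s - cis t) \<le> \<bar>s - t\<bar>"
proof -
  have "cis s - cis t = cis t * (exp (\<i> * of_real (s - t)) - 1)"
    by (simp add: cis_conv_exp exp_add exp_diff ring_distribs)
  moreover have "norm (exp (\<i> * of_real (s - t)) - 1) \<le> norm (\<i> * of_real (s - t))"
    using dist_exp_i_1[of "s - t"] abs_sin_x_le_abs_x[of "(s - t) / 2"]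
    by (simp only: norm_mult norm_of_real norm_ii) simp
  ultimately show ?thesis
    by (simp add: norm_mult flip: of_real_diff)
qed

lemma norm_wave_diff_le: "norm (wave \<xi> x - wave \<eta> x) \<le> 2 * pi * norm (\<xi> - \<eta>) * norm x"
proof -
  have "norm (wave \<xi> x - wave \<eta> x) \<le> \<bar>2 * pi * ((\<xi> - \<eta>) \<bullet> x)\<bar>"
    using norm_cis_diff_le[of "2 * pi * (\<xi> \<bullet> x)" "2 * pi * (\<eta> \<bullet> x)"]
    by (simp add: wave_def inner_diff_left algebra_simps)
  also have "\<dots> \<le> 2 * pi * (norm (\<xi> - \<eta>) * norm x)"
    using Cauchy_Schwarz_ineq2[of "\<xi> - \<eta>" x] by (simp add: abs_mult)
  finally show ?thesis
    by (simp add: mult.assoc)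
qed

lemma fourier_wave: "fourier g \<xi> = (LINT x|lborel. wave (- \<xi>) x * g x)"
  unfolding fourier_def wave_def
  by (rule Bochner_Integration.integral_cong) (simp_all add: cis_conv_exp mult_ac)

text \<open>
  \<open>band K f\<close> says that \<open>f\<close> is an average of plane waves with frequencies in \<open>K\<close>, expressed
  without the averaging measure: every closed disc containing the pairings of all plane
  waves \<open>wave \<eta>\<close>, \<open>\<eta> \<in> K\<close>, with a given integrable density contains the pairing of \<open>f\<close> as well.
  The substitution \<open>T\<close> lets convolutions with dilated functions be read as such pairings.
\<close>

definition band :: "'a::euclidean_space set \<Rightarrow> ('a \<Rightarrow> complex) \<Rightarrow> bool" where
  "band K f \<longleftrightarrow> f \<in> borel_measurable borel \<and> (\<forall>x. norm (f x) \<le> 1) \<and>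
     (\<forall>T \<in> borel_measurable borel. \<forall>(g :: 'a \<Rightarrow> complex) w \<epsilon>. integrable lborel g \<longrightarrow>
        (\<forall>\<eta>\<in>K. norm ((LINT z|lborel. wave \<eta> (T z) * g z) - w) \<le> \<epsilon>) \<longrightarrow>
        norm ((LINT z|lborel. f (T z) * g z) - w) \<le> \<epsilon>)"

lemma bandD:
  fixes T :: "'a::euclidean_space \<Rightarrow> 'a"
  assumes "band K f" "T \<in> borel_measurable borel" "integrable lborel g"
    "\<And>\<eta>. \<eta> \<in> K \<Longrightarrow> norm ((LINT z|lborel. wave \<eta> (T z) * g z) - w) \<le> \<epsilon>"
  shows "norm ((LINT z|lborel. f (T z) * g z) - w) \<le> \<epsilon>"
  using assms(1)[unfolded band_def, THEN conjunct2, THEN conjunct2, THEN bspec, OF assms(2), THEN spec,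
      THEN spec, THEN spec, THEN mp, THEN mp, OF assms(3)] assms(4)
  by auto

lemma band_wave: "\<xi> \<in> K \<Longrightarrow> band K (wave \<xi>)"
  by (auto simp: band_def)

text \<open>This is sin(2 pi u) / (2 pi u), continued by 1 at u = 0. Written as an average of
  characters over a probability measure, multiplication by it visibly averages frequency
  translations.\<close>

definition sinc :: "real \<Rightarrow> complex" where
  "sinc u = (LINT t|uniform_measure lborel {-1..1}. cis (2 * pi * t * u))"

interpretation unif: prob_space "uniform_measure lborel {-1..1::real}"
  by (rule prob_space_uniform_measure) auto

lemma measurable_sinc [measurable]: "sinc \<in> borel_measurable borel"
  unfolding sinc_def by measurable

lemma norm_sinc_le_1: "norm (sinc u) \<le> 1"
proof -
  have "norm (sinc u) \<le> (LINT t|uniform_measure lborel {-1..1::real}. norm (cis (2 * pi * t * u)))"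
    unfolding sinc_def by (rule integral_norm_bound)
  then show ?thesis
    by (simp add: unif.prob_space)
qed

text \<open>Integrating the character explicitly gives |u| |sinc u| \<le> 1 / (2 pi). Adding the
  trivial bound 1 yields a form that has no singularity at 0 and can be multiplied over
  coordinates.\<close>

lemma sinc_decay: "norm (sinc u) \<le> 2 / (1 + \<bar>u\<bar>)"
proof (cases "u = 0")
  case False
  define G where "G t = cis (2 * pi * t * u) / (2 * pi * u * \<i>)" for t :: real
  have "has_bochner_integral lborel (\<lambda>t. indicator {-1..1::real} t *\<^sub>R cis (2 * pi * t * u)) (G 1 - G (-1))"
  proof (rule has_bochner_integral_FTC_Icc)
    fix t :: real
    define A where "A = of_real (2 * pi * u) * \<i>"
    have "A \<noteq> 0" and cis: "cis (2 * pi * t * u) = exp (t *\<^sub>R A)" for t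
      using False by (simp_all add: A_def cis_conv_exp scaleR_conv_of_real mult_ac)
    have "((\<lambda>t. exp (t *\<^sub>R A) / A) has_vector_derivative exp (t *\<^sub>R A) * A / A) (at t within {-1..1})"
      by (intro has_vector_derivative_divide exp_scaleR_has_vector_derivative_right)
    moreover have "G = (\<lambda>t. exp (t *\<^sub>R A) / A)"
      unfolding G_def cis by (simp add: A_def)
    ultimately show "(G has_vector_derivative cis (2 * pi * t * u)) (at t within {-1..1})"
      using \<open>A \<noteq> 0\<close> by (simp add: cis)
  qed (auto intro!: continuous_intros)
  then have *: "(LINT t|lborel. indicator {-1..1::real} t *\<^sub>R cis (2 * pi * t * u)) = G 1 - G (-1)"
    by (simp add: has_bochner_integral_integral_eq)
  have "sinc u = (LINT t|density lborel (\<lambda>t. ennreal (indicator {-1..1} t / 2)). cis (2 * pi * t * u))"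
    unfolding sinc_def uniform_measure_def
    by (intro arg_cong2[where f="integral\<^sup>L"] density_cong AE_I2 refl)
       (auto simp: indicator_def divide_ennreal_def)
  also have "\<dots> = (LINT t|lborel. (indicator {-1..1} t / 2) *\<^sub>R cis (2 * pi * t * u))"
    by (subst integral_density) auto
  also have "\<dots> = (LINT t|lborel. (1 / 2) *\<^sub>R (indicator {-1..1} t *\<^sub>R cis (2 * pi * t * u)))"
    by simp
  also have "\<dots> = (1 / 2) *\<^sub>R (G 1 - G (-1))"
    by (subst integral_scaleR_right) (simp only: *)
  finally have "norm (sinc u) \<le> (norm (G 1) + norm (G (-1))) / 2"
    by (simp add: norm_divide norm_triangle_ineq4)
  also have "\<dots> = 1 / (2 * pi * \<bar>u\<bar>)"
    by (simp add: G_def norm_divide norm_mult)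
  finally have "norm (sinc u) * \<bar>u\<bar> \<le> 1 / (2 * pi)"
    using False by (simp add: field_simps)
  moreover have "1 / (2 * pi) \<le> 1"
    using pi_gt3 by (simp add: field_simps)
  ultimately have "norm (sinc u) * \<bar>u\<bar> \<le> 1"
    by linarith
  then have "norm (sinc u) * (1 + \<bar>u\<bar>) \<le> 2"
    using norm_sinc_le_1[of u] by (simp add: algebra_simps)
  then show ?thesis
    by (simp add: pos_le_divide_eq)
qed (use norm_sinc_le_1[of 0] in auto)

text \<open>By Fubini the pairing of the product is the mean over t of pairings of \<open>f\<close>
  with modulated densities. Each of these lies in the given disc because K + t b is contained in K',
  and a disc is convex and closed under means.\<close>

lemma band_mult_sinc:
  fixes f :: "'a::euclidean_space \<Rightarrow> complex"
  assumes f: "band K f" and K: "\<And>\<eta> t. \<eta> \<in> K \<Longrightarrow> \<bar>t\<bar> \<le> 1 \<Longrightarrow> \<eta> + t *\<^sub>R b \<in> K'"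
  shows "band K' (\<lambda>x. f x * sinc (b \<bullet> x))"
  unfolding band_def
proof (intro conjI ballI allI impI)
  have fm [measurable]: "f \<in> borel_measurable borel" and f1: "\<And>x. norm (f x) \<le> 1"
    using f by (auto simp: band_def)
  show "(\<lambda>x. f x * sinc (b \<bullet> x)) \<in> borel_measurable borel"
    by measurable
  show "norm (f x * sinc (b \<bullet> x)) \<le> 1" for x
    using f1[of x] norm_sinc_le_1[of "b \<bullet> x"] by (simp add: norm_mult mult_le_one)
  fix T :: "'a \<Rightarrow> 'a" and g :: "'a \<Rightarrow> complex" and w :: complex and \<epsilon> :: real
  assume T [measurable]: "T \<in> borel_measurable borel" and g: "integrable lborel g"
    and le: "\<forall>\<eta>\<in>K'. norm ((LINT z|lborel. wave \<eta> (T z) * g z) - w) \<le> \<epsilon>"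
  have gm [measurable]: "g \<in> borel_measurable lborel"
    using g by auto
  let ?U = "uniform_measure lborel {-1..1::real}"
  interpret P: pair_sigma_finite ?U "lborel :: 'a measure" ..
  \<comment> \<open>The modulation is grouped with \<open>g\<close>:
    \<open>wave (t *\<^sub>R b) (T z) * g z\<close> is again an integrable density, so the band
    property of \<open>f\<close> applies to it for each fixed t.\<close>
  define h where "h t z = f (T z) * (wave (t *\<^sub>R b) (T z) * g z)" for t z
  have hm [measurable]: "case_prod h \<in> borel_measurable (?U \<Otimes>\<^sub>M lborel)"
    unfolding h_def by measurable
  have wg: "integrable lborel (\<lambda>z. wave (t *\<^sub>R b) (T z) * g z)" for t
    by (rule Bochner_Integration.integrable_bound[OF g]) (auto simp: norm_mult)
  have hi: "integrable lborel (h t)" for t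
    unfolding h_def
    by (rule Bochner_Integration.integrable_bound[OF g]) (auto simp: norm_mult f1 mult_left_le_one_le)
  have int: "integrable (?U \<Otimes>\<^sub>M lborel) (case_prod h)"
  proof (rule P.Fubini_integrable[OF hm])
    show "AE t in ?U. integrable lborel (\<lambda>z. case_prod h (t, z))"
      using hi by simp
  qed (simp add: h_def norm_mult)
  have eq: "(LINT z|lborel. f (T z) * sinc (b \<bullet> T z) * g z) = (LINT t|?U. LINT z|lborel. h t z)"
  proof -
    have "(LINT z|lborel. f (T z) * sinc (b \<bullet> T z) * g z) = (LINT z|lborel. LINT t|?U. h t z)"
    proof (rule Bochner_Integration.integral_cong[OF refl])
      fix z
      have "(LINT t|?U. h t z) = (LINT t|?U. f (T z) * g z * cis (2 * pi * t * (b \<bullet> T z)))"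
        by (rule Bochner_Integration.integral_cong) (simp_all add: h_def wave_def mult_ac)
      then show "f (T z) * sinc (b \<bullet> T z) * g z = (LINT t|?U. h t z)"
        by (simp add: sinc_def)
    qed
    then show ?thesis
      using P.Fubini_integral[OF int] by simp
  qed
  have bd: "norm ((LINT z|lborel. h t z) - w) \<le> \<epsilon>" if "\<bar>t\<bar> \<le> 1" for t
    unfolding h_def
  proof (rule bandD[OF f T wg])
    fix \<eta> assume "\<eta> \<in> K"
    then have "norm ((LINT z|lborel. wave (\<eta> + t *\<^sub>R b) (T z) * g z) - w) \<le> \<epsilon>"
      using le K that by blast
    then show "norm ((LINT z|lborel. wave \<eta> (T z) * (wave (t *\<^sub>R b) (T z) * g z)) - w) \<le> \<epsilon>"
      by (simp add: wave_add_left mult.assoc)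
  qed
  have AE: "AE t in ?U. norm ((LINT z|lborel. h t z) - w) \<le> \<epsilon>"
    by (rule AE_uniform_measureI) (use bd in \<open>auto intro!: AE_I2\<close>)
  have hI: "integrable ?U (\<lambda>t. LINT z|lborel. h t z)"
    using P.integrable_fst[OF int] by simp
  have "(LINT t|?U. LINT z|lborel. h t z) - w = (LINT t|?U. (LINT z|lborel. h t z) - w)"
    using hI by (simp add: unif.prob_space)
  also have "norm \<dots> \<le> (LINT t|?U. norm ((LINT z|lborel. h t z) - w))"
    by (rule integral_norm_bound)
  also have "\<dots> \<le> (LINT t|?U. \<epsilon>)"
    by (rule integral_mono_AE) (use hI AE in auto)
  finally show "norm ((LINT z|lborel. f (T z) * sinc (b \<bullet> T z) * g z) - w) \<le> \<epsilon>"
    by (simp add: eq unif.prob_space)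
qed

text \<open>On the Fourier side this is a tensor-product B-spline: in each coordinate the m-fold
  convolution of the uniform density on [-\<mu>, \<mu>], translated to \<xi>. Thus \<mu> is the
  frequency width, 1/\<mu> the spatial width, and m the order of decay.\<close>

definition bump :: "nat \<Rightarrow> 'a::euclidean_space \<Rightarrow> real \<Rightarrow> 'a \<Rightarrow> complex" where
  "bump m \<xi> \<mu> x = wave \<xi> x * (\<Prod>b\<in>Basis. sinc (\<mu> * (b \<bullet> x)) ^ m)"

lemma band_mult_sinc_power:
  assumes "band (cball \<xi> r) f"
  shows "band (cball \<xi> (r + m * norm b)) (\<lambda>x. f x * sinc (b \<bullet> x) ^ m)"
proof (induction m)
  case 0
  then show ?case using assms by simp
next
  case (Suc m)
  have "band (cball \<xi> (r + Suc m * norm b)) (\<lambda>x. (f x * sinc (b \<bullet> x) ^ m) * sinc (b \<bullet> x))"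
  proof (rule band_mult_sinc[OF Suc])
    fix \<eta> and t :: real assume "\<eta> \<in> cball \<xi> (r + m * norm b)" "\<bar>t\<bar> \<le> 1"
    moreover have "dist \<xi> (\<eta> + t *\<^sub>R b) \<le> dist \<xi> \<eta> + \<bar>t\<bar> * norm b"
      using dist_triangle[of \<xi> "\<eta> + t *\<^sub>R b" \<eta>] by (simp add: dist_norm)
    moreover have "\<bar>t\<bar> * norm b \<le> norm b"
      using \<open>\<bar>t\<bar> \<le> 1\<close> by (simp add: mult_left_le_one_le)
    ultimately show "\<eta> + t *\<^sub>R b \<in> cball \<xi> (r + Suc m * norm b)"
      by (simp add: algebra_simps)
  qed
  then show ?case by (simp add: mult_ac)
qed

text \<open>Each of the DIM * m sinc factors moves a frequency by at most \<mu>, so the radii add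
  up.\<close>

lemma band_bump:
  fixes \<xi> :: "'a::euclidean_space" and \<mu> :: real
  assumes "\<mu> \<ge> 0"
  shows "band (cball \<xi> (DIM('a) * m * \<mu>)) (bump m \<xi> \<mu>)"
proof -
  have "band (cball \<xi> (card A * m * \<mu>)) (\<lambda>x. wave \<xi> x * (\<Prod>b\<in>A. sinc (\<mu> * (b \<bullet> x)) ^ m))"
    if "finite A" "A \<subseteq> Basis" for A :: "'a set"
    using that
  proof (induction A rule: finite_induct)
    case empty
    then show ?case by (simp add: band_wave)
  next
    case (insert a A)
    then have "band (cball \<xi> (card A * m * \<mu> + m * norm (\<mu> *\<^sub>R a)))
        (\<lambda>x. (wave \<xi> x * (\<Prod>b\<in>A. sinc (\<mu> * (b \<bullet> x)) ^ m)) * sinc ((\<mu> *\<^sub>R a) \<bullet> x) ^ m)"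
      by (intro band_mult_sinc_power) auto
    then show ?case
      using insert assms by (simp add: algebra_simps norm_Basis)
  qed
  from this[of Basis] show ?thesis
    by (simp add: bump_def[abs_def])
qed

text \<open>Expanding the product leaves only further nonnegative terms. It converts decay in each
  coordinate separately into decay in the norm.\<close>

lemma one_plus_sum_le_prod:
  fixes a :: "'b \<Rightarrow> real"
  assumes "finite A" "\<And>b. b \<in> A \<Longrightarrow> a b \<ge> 0"
  shows "1 + (\<Sum>b\<in>A. a b) \<le> (\<Prod>b\<in>A. 1 + a b)"
  using assms
proof (induction A rule: finite_induct)
  case (insert x A)
  have "1 + (a x + (\<Sum>b\<in>A. a b)) \<le> (1 + a x) * (1 + (\<Sum>b\<in>A. a b))"
    using insert.prems by (simp add: algebra_simps sum_nonneg)
  also have "\<dots> \<le> (1 + a x) * (\<Prod>b\<in>A. 1 + a b)"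
    using insert by (intro mult_left_mono) auto
  finally show ?case
    using insert by simp
qed simp

text \<open>Multiplying the one-dimensional bounds gives the denominator \<Prod>(1 + \<mu> |x_b|),
  which dominates 1 plus \<mu> times the l1 norm, hence 1 + \<mu> |x|.\<close>

lemma bump_decay:
  fixes \<xi> :: "'a::euclidean_space" and \<mu> :: real
  assumes "\<mu> \<ge> 0"
  shows "norm (bump m \<xi> \<mu> x) \<le> 2 ^ (DIM('a) * m) / (1 + \<mu> * norm x) ^ m"
proof -
  have "norm (bump m \<xi> \<mu> x) = (\<Prod>b\<in>Basis. norm (sinc (\<mu> * (b \<bullet> x)))) ^ m"
    by (simp add: bump_def norm_mult prod_norm[symmetric] norm_power prod_power_distrib)
  also have "\<dots> \<le> (2 ^ DIM('a) / (1 + \<mu> * norm x)) ^ m"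
  proof (rule power_mono)
    have "norm (sinc (\<mu> * (b \<bullet> x))) \<le> 2 / (1 + \<mu> * \<bar>b \<bullet> x\<bar>)" for b
      using sinc_decay[of "\<mu> * (b \<bullet> x)"] assms by (simp add: abs_mult)
    then have "(\<Prod>b\<in>Basis. norm (sinc (\<mu> * (b \<bullet> x)))) \<le> (\<Prod>b\<in>Basis. 2 / (1 + \<mu> * \<bar>b \<bullet> x\<bar>))"
      by (intro prod_mono) simp
    also have "\<dots> = 2 ^ DIM('a) / (\<Prod>b\<in>Basis. 1 + \<mu> * \<bar>b \<bullet> x\<bar>)"
      by (simp add: prod_dividef)
    also have "\<dots> \<le> 2 ^ DIM('a) / (1 + \<mu> * norm x)"
    proof (rule divide_left_mono)
      have "1 + \<mu> * norm x \<le> 1 + (\<Sum>b\<in>Basis. \<mu> * \<bar>b \<bullet> x\<bar>)"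
        using norm_le_l1[of x] assms
        by (simp flip: sum_distrib_left add: mult_left_mono inner_commute)
      also have "\<dots> \<le> (\<Prod>b\<in>Basis. 1 + \<mu> * \<bar>b \<bullet> x\<bar>)"
        using assms by (intro one_plus_sum_le_prod) auto
      finally show "1 + \<mu> * norm x \<le> (\<Prod>b\<in>Basis. 1 + \<mu> * \<bar>b \<bullet> x\<bar>)" .
      show "0 < (\<Prod>b\<in>Basis. 1 + \<mu> * \<bar>b \<bullet> x\<bar>) * (1 + \<mu> * norm x)"
        using assms by (auto intro!: mult_pos_pos prod_pos add_pos_nonneg)
    qed simp
    finally show "(\<Prod>b\<in>Basis. norm (sinc (\<mu> * (b \<bullet> x)))) \<le> 2 ^ DIM('a) / (1 + \<mu> * norm x)" .
  qed (auto intro: prod_nonneg)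
  finally show ?thesis
    by (simp add: power_divide power_mult)
qed

section \<open>Quasi-norm bounds\<close>

lemma enn_powr_mono: "x \<le> y \<Longrightarrow> r \<ge> 0 \<Longrightarrow> enn_powr x r \<le> enn_powr y r"
  by (auto simp: enn_powr_def top_unique enn2real_mono less_top intro!: ennreal_leI powr_mono2)

lemma enn_powr_ennreal: "x \<ge> 0 \<Longrightarrow> enn_powr (ennreal x) r = ennreal (x powr r)"
  by (simp add: enn_powr_def)

lemma enn_powr_zero [simp]: "enn_powr 0 r = 0"
  by (simp add: enn_powr_def)

lemma enn2real_pos: "0 < p \<Longrightarrow> p \<noteq> \<infinity> \<Longrightarrow> 0 < enn2real p"
  by (cases p) auto

lemma enn2real_inverse: "p \<noteq> \<infinity> \<Longrightarrow> 0 < p \<Longrightarrow> enn2real (1 / p) = 1 / enn2real p"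
  by (cases p) (auto simp: divide_ennreal simp flip: ennreal_1)

lemma ex_power_two_between:
  fixes y :: real
  assumes "1 \<le> y"
  shows "\<exists>k::nat. 2 ^ k \<le> y \<and> y \<le> 2 ^ (k + 1)"
proof -
  have ex: "\<exists>n. y < 2 ^ n"
    by (rule real_arch_pow) simp
  define n where "n = (LEAST n. y < 2 ^ n)"
  have n: "y < 2 ^ n"
    unfolding n_def by (rule LeastI_ex[OF ex])
  with assms obtain k where k: "n = Suc k"
    by (cases n) auto
  then have "\<not> y < 2 ^ k"
    using not_less_Least[of k "\<lambda>n. y < 2 ^ n"] by (simp add: n_def)
  with n k show ?thesis
    by (intro exI[of _ k]) auto
qed

text \<open>Dyadic balls replace polar coordinates here.\<close>

lemma nn_integral_decay_le:
  fixes s :: real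
  assumes s: "s > DIM('a::euclidean_space)"
  obtains C where "C > 0" "\<And>\<mu>. \<mu> > 0 \<Longrightarrow>
    (\<integral>\<^sup>+ (x::'a). ennreal ((1 + \<mu> * norm x) powr (- s)) \<partial>lborel) \<le> ennreal (C * \<mu> powr (- real DIM('a)))"
proof -
  let ?d = "DIM('a)"
  let ?V = "unit_ball_vol ?d"
  \<comment> \<open>Ratio of the geometric series below: on the k-th shell the integrand is at most
    2^(-ks), while the ball around it has volume proportional to 2^(kd). The condition s > d is
    exactly q < 1.\<close>
  define q where "q = 2 powr (?d - s)"
  have q: "0 < q" "q < 1"
    using s powr_less_mono[of "?d - s" 0 2] by (auto simp: q_def)
  have V: "?V > 0"
    by (simp add: unit_ball_vol_pos)
  define C where "C = ?V * 2 ^ ?d / (1 - q)"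
  have "C > 0"
    using q V by (simp add: C_def)
  moreover have "(\<integral>\<^sup>+ (x::'a). ennreal ((1 + \<mu> * norm x) powr (- s)) \<partial>lborel) \<le> ennreal (C * \<mu> powr (- real ?d))"
    if \<mu>: "\<mu> > 0" for \<mu>
  proof -
    let ?B = "\<lambda>k::nat. cball (0::'a) (2 ^ (k + 1) / \<mu>)"
    \<comment> \<open>Although the balls are nested, the single term whose dyadic shell contains x
      already dominates the integrand.\<close>
    have pw: "ennreal ((1 + \<mu> * norm x) powr (- s))
        \<le> (\<Sum>k. ennreal ((2 ^ k) powr (- s)) * indicator (?B k) x)" for x :: 'a
    proof -
      obtain k :: nat where k: "2 ^ k \<le> 1 + \<mu> * norm x" "1 + \<mu> * norm x \<le> 2 ^ (k + 1)"
        using ex_power_two_between[of "1 + \<mu> * norm x"] \<mu> by auto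
      then have x: "x \<in> ?B k"
        using \<mu> by (simp add: field_simps)
      have "ennreal ((1 + \<mu> * norm x) powr (- s)) \<le> ennreal ((2 ^ k) powr (- s)) * indicator (?B k) x"
        using k(1) s x by (auto intro!: ennreal_leI powr_mono2')
      also have "\<dots> \<le> (\<Sum>k. ennreal ((2 ^ k) powr (- s)) * indicator (?B k) x)"
        using sum_le_suminf[OF summableI, of "{k}" "\<lambda>k. ennreal ((2 ^ k) powr (- s)) * indicator (?B k) x"]
        by (simp only: sum.insert sum.empty finite.intros empty_iff not_False_eq_True add_0_right) simp
      finally show ?thesis .
    qed
    have ball: "ennreal ((2 ^ k) powr (- s)) * emeasure lborel (?B k)
        = ennreal (?V * 2 ^ ?d * \<mu> powr (- real ?d) * q ^ k)" for k
    proof -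
      have eq: "(2 ^ k) powr (- s) * (?V * (2 ^ (k + 1) / \<mu>) ^ ?d) = ?V * 2 ^ ?d * \<mu> powr (- real ?d) * q ^ k"
      proof -
        have "(2 ^ (k + 1) / \<mu>) ^ ?d = 2 ^ ?d * (2 powr (k * ?d)) * \<mu> powr (- real ?d)"
          using \<mu> by (simp add: power_divide power_mult_distrib powr_minus powr_realpow field_simps
              powr_powr flip: power_mult powr_realpow)
        moreover have "(2 ^ k) powr (- s) = 2 powr (- s * k)" "q ^ k = 2 powr ((?d - s) * k)"
          by (simp_all add: q_def powr_powr mult.commute flip: powr_realpow)
        moreover have "2 powr (- s * k) * 2 powr (k * ?d) = 2 powr ((?d - s) * k)"
          by (simp add: algebra_simps flip: powr_add)
        ultimately show ?thesis
          by (simp add: mult_ac)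
      qed
      have "ennreal ((2 ^ k) powr (- s)) * emeasure lborel (?B k)
          = ennreal ((2 ^ k) powr (- s) * (?V * (2 ^ (k + 1) / \<mu>) ^ ?d))"
        using \<mu> V by (simp add: emeasure_cball ennreal_mult'[symmetric])
      then show ?thesis
        by (simp only: eq)
    qed
    have "(\<integral>\<^sup>+ (x::'a). ennreal ((1 + \<mu> * norm x) powr (- s)) \<partial>lborel)
        \<le> (\<integral>\<^sup>+ x. (\<Sum>k. ennreal ((2 ^ k) powr (- s)) * indicator (?B k) x) \<partial>lborel)"
      using pw by (rule nn_integral_mono)
    also have "\<dots> = (\<Sum>k. \<integral>\<^sup>+ x. ennreal ((2 ^ k) powr (- s)) * indicator (?B k) x \<partial>lborel)"
      by (intro nn_integral_suminf borel_measurable_times_ennreal borel_measurable_const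
          borel_measurable_indicator) simp
    also have "\<dots> = (\<Sum>k. ennreal ((2 ^ k) powr (- s)) * emeasure lborel (?B k))"
      by (intro arg_cong[where f=suminf] ext nn_integral_cmult_indicator) simp
    also have "\<dots> = (\<Sum>k. ennreal (?V * 2 ^ ?d * \<mu> powr (- real ?d) * q ^ k))"
      by (simp only: ball)
    also have "\<dots> = ennreal (?V * 2 ^ ?d * \<mu> powr (- real ?d) * (1 / (1 - q)))"
    proof (rule suminf_ennreal_eq)
      show "0 \<le> ?V * 2 ^ ?d * \<mu> powr (- real ?d) * q ^ k" for k
        using q V by (intro mult_nonneg_nonneg) auto
      show "(\<lambda>k. ?V * 2 ^ ?d * \<mu> powr (- real ?d) * q ^ k) sums (?V * 2 ^ ?d * \<mu> powr (- real ?d) * (1 / (1 - q)))"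
        using q by (intro sums_mult geometric_sums) simp
    qed
    also have "\<dots> = ennreal (C * \<mu> powr (- real ?d))"
      by (simp add: C_def mult_ac)
    finally show ?thesis
      by simp
  qed
  ultimately show ?thesis
    using that by blast
qed

text \<open>The p-th power of the majorant is integrable because m p > d, and integrating it scales
  like \<mu>^(-d). Since \<open>enn2real (1 / p)\<close> is 0 for p = \<infinity>, one formula
  covers both cases. The constant precedes \<open>g\<close>, \<mu> and \<open>B\<close>, so it will
  not depend on j.\<close>

lemma Lp_norm_le:
  assumes p: "0 < p" and m: "DIM('a::euclidean_space) * enn2real (1 / p) < real m"
  obtains C where "C > 0" "\<And>(g::'a \<Rightarrow> complex) \<mu> B. g \<in> borel_measurable borel \<Longrightarrow> \<mu> > 0 \<Longrightarrow> B \<ge> 0 \<Longrightarrow>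
    (\<And>x. norm (g x) \<le> B / (1 + \<mu> * norm x) ^ m) \<Longrightarrow>
    Lp_norm p g \<le> ennreal (C * B * \<mu> powr (- (DIM('a) * enn2real (1 / p))))"
proof (cases "p = \<infinity>")
  case True
  have "Lp_norm p g \<le> ennreal (1 * B * \<mu> powr (- (DIM('a) * enn2real (1 / p))))"
    if "g \<in> borel_measurable borel" "\<mu> > 0" "B \<ge> 0" "\<And>x. norm (g x) \<le> B / (1 + \<mu> * norm x) ^ m"
    for g :: "'a \<Rightarrow> complex" and \<mu> B
  proof -
    have "norm (g x) \<le> B" for x
    proof -
      have "1 \<le> (1 + \<mu> * norm x) ^ m"
        using that(2) by (intro one_le_power) simp
      then have "B / (1 + \<mu> * norm x) ^ m \<le> B"
        using that(3) divide_left_mono[of 1 "(1 + \<mu> * norm x) ^ m" B] by simp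
      then show ?thesis using that(4)[of x] by simp
    qed
    then show ?thesis
      using True that unfolding Lp_norm_def by (auto intro!: esssup_I ennreal_leI)
  qed
  then show ?thesis
    by (rule that[OF zero_less_one])
next
  case False
  let ?r = "enn2real p"
  let ?d = "DIM('a)"
  have r: "?r > 0" "enn2real (1 / p) = 1 / ?r"
    using p False by (auto simp: enn2real_pos enn2real_inverse)
  have "m * ?r > ?d"
    using m r by (simp add: field_simps)
  then obtain C where C: "C > 0" "\<And>\<mu>. \<mu> > 0 \<Longrightarrow>
    (\<integral>\<^sup>+ (x::'a). ennreal ((1 + \<mu> * norm x) powr (- (m * ?r))) \<partial>lborel) \<le> ennreal (C * \<mu> powr (- real ?d))"
    by (rule nn_integral_decay_le) blast
  have "Lp_norm p g \<le> ennreal (C powr (1 / ?r) * B * \<mu> powr (- (?d * enn2real (1 / p))))"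
    if g: "g \<in> borel_measurable borel" and \<mu>: "\<mu> > 0" and B: "B \<ge> 0"
      and le: "\<And>x. norm (g x) \<le> B / (1 + \<mu> * norm x) ^ m"
    for g :: "'a \<Rightarrow> complex" and \<mu> B
  proof -
    have pw: "ennreal (norm (g x) powr ?r) \<le> ennreal (B powr ?r) * ennreal ((1 + \<mu> * norm x) powr (- (m * ?r)))" for x
    proof -
      have pos: "0 < 1 + \<mu> * norm x"
        using \<mu> by (intro add_pos_nonneg) auto
      have "norm (g x) powr ?r \<le> (B / (1 + \<mu> * norm x) ^ m) powr ?r"
        using le r by (intro powr_mono2) auto
      also have "\<dots> = B powr ?r * (1 + \<mu> * norm x) powr (- (m * ?r))"
        using pos B by (simp add: powr_divide powr_powr powr_minus field_simps flip: powr_realpow)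
      finally show ?thesis
        by (simp add: ennreal_leI flip: ennreal_mult')
    qed
    have "(\<integral>\<^sup>+ x. ennreal (norm (g x) powr ?r) \<partial>lborel)
        \<le> (\<integral>\<^sup>+ (x::'a). ennreal (B powr ?r) * ennreal ((1 + \<mu> * norm x) powr (- (m * ?r))) \<partial>lborel)"
      using pw by (rule nn_integral_mono)
    also have "\<dots> \<le> ennreal (B powr ?r) * ennreal (C * \<mu> powr (- real ?d))"
      using C(2)[OF \<mu>] by (subst nn_integral_cmult) (auto intro: mult_left_mono)
    also have "\<dots> = ennreal (B powr ?r * (C * \<mu> powr (- real ?d)))"
      by (simp add: ennreal_mult')
    finally have "Lp_norm p g \<le> enn_powr (ennreal (B powr ?r * (C * \<mu> powr (- real ?d)))) (1 / ?r)"
      using False r unfolding Lp_norm_def by (auto intro: enn_powr_mono)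
    also have "\<dots> = ennreal (C powr (1 / ?r) * B * \<mu> powr (- (?d * enn2real (1 / p))))"
      using C(1) B \<mu> r by (simp add: enn_powr_ennreal powr_mult powr_powr mult_ac)
    finally show ?thesis .
  qed
  then show ?thesis
    using that[of "C powr (1 / ?r)"] C(1) by simp
qed

text \<open>The ball of radius \<rho>/\<mu>, on which |g| is at least B, has volume proportional to
  \<mu>^(-d). This is the same power as in the upper bound.\<close>

lemma Lp_norm_ge:
  assumes p: "0 < p" and \<rho>: "\<rho> > 0"
  obtains c where "c > 0" "\<And>(g::'a::euclidean_space \<Rightarrow> complex) \<mu> B. \<mu> > 0 \<Longrightarrow> B \<ge> 0 \<Longrightarrow>
    (\<And>x. \<mu> * norm x \<le> \<rho> \<Longrightarrow> B \<le> norm (g x)) \<Longrightarrow>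
    ennreal (c * B * \<mu> powr (- (DIM('a) * enn2real (1 / p)))) \<le> Lp_norm p g"
proof (cases "p = \<infinity>")
  case True
  have "ennreal (1 * B * \<mu> powr (- (DIM('a) * enn2real (1 / p)))) \<le> Lp_norm p g"
    if \<mu>: "\<mu> > 0" and B: "B \<ge> 0" and ge: "\<And>x. \<mu> * norm x \<le> \<rho> \<Longrightarrow> B \<le> norm (g x)"
    for g :: "'a \<Rightarrow> complex" and \<mu> B
  proof -
    let ?S = "cball (0::'a) (\<rho> / \<mu>)"
    \<comment> \<open>An essential supremum below B would make the whole ball a null set.\<close>
    have "ennreal B \<le> esssup lborel (\<lambda>x. ennreal (norm (g x)))" (is "_ \<le> ?e")
    proof (rule ccontr)
      assume "\<not> ?thesis"
      then have lt: "?e < ennreal B"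
        by simp
      have "AE x in lborel. x \<notin> ?S"
        using esssup_AE[of "\<lambda>x. ennreal (norm (g x))" lborel]
      proof eventually_elim
        case (elim x)
        then have "ennreal (norm (g x)) < ennreal B"
          using lt by (rule le_less_trans)
        then have "norm (g x) < B"
          by (simp add: ennreal_less_iff)
        then show ?case
          using ge[of x] \<mu> by (auto simp: field_simps)
      qed
      then have "emeasure lborel ?S = 0"
        by (subst (asm) AE_iff_measurable[OF _ refl]) (auto simp: cball_def)
      moreover have "unit_ball_vol DIM('a) * (\<rho> / \<mu>) ^ DIM('a) > 0"
        using \<rho> \<mu> by (intro mult_pos_pos) (auto simp: unit_ball_vol_pos)
      ultimately show False
        using \<rho> \<mu> by (simp add: emeasure_cball)
    qed
    then show ?thesis
      using True that by (simp add: Lp_norm_def)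
  qed
  then show ?thesis
    using that[of 1] by simp
next
  case False
  let ?r = "enn2real p"
  let ?d = "DIM('a)"
  let ?V = "unit_ball_vol ?d"
  have r: "?r > 0" "enn2real (1 / p) = 1 / ?r"
    using p False by (auto simp: enn2real_pos enn2real_inverse)
  have V: "?V > 0"
    by (simp add: unit_ball_vol_pos)
  have "ennreal ((?V * \<rho> ^ ?d) powr (1 / ?r) * B * \<mu> powr (- (?d * enn2real (1 / p)))) \<le> Lp_norm p g"
    if \<mu>: "\<mu> > 0" and B: "B \<ge> 0" and ge: "\<And>x. \<mu> * norm x \<le> \<rho> \<Longrightarrow> B \<le> norm (g x)"
    for g :: "'a \<Rightarrow> complex" and \<mu> B
  proof -
    let ?S = "cball (0::'a) (\<rho> / \<mu>)"
    have pw: "ennreal (B powr ?r) * indicator ?S x \<le> ennreal (norm (g x) powr ?r)" for x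
      using ge[of x] r B \<mu> by (auto simp: indicator_def field_simps intro!: ennreal_leI powr_mono2)
    have "ennreal (B powr ?r * (?V * \<rho> ^ ?d * \<mu> powr (- real ?d))) = ennreal (B powr ?r) * emeasure lborel ?S"
      using \<rho> \<mu> V by (simp add: emeasure_cball power_divide powr_minus powr_realpow field_simps
          flip: ennreal_mult')
    also have "\<dots> = (\<integral>\<^sup>+ x. ennreal (B powr ?r) * indicator ?S x \<partial>lborel)"
      by (simp add: nn_integral_cmult_indicator)
    also have "\<dots> \<le> (\<integral>\<^sup>+ x. ennreal (norm (g x) powr ?r) \<partial>lborel)"
      using pw by (rule nn_integral_mono)
    finally have "enn_powr (ennreal (B powr ?r * (?V * \<rho> ^ ?d * \<mu> powr (- real ?d)))) (1 / ?r) \<le> Lp_norm p g"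
      using False r unfolding Lp_norm_def by (auto intro: enn_powr_mono)
    moreover have "enn_powr (ennreal (B powr ?r * (?V * \<rho> ^ ?d * \<mu> powr (- real ?d)))) (1 / ?r)
        = ennreal ((?V * \<rho> ^ ?d) powr (1 / ?r) * B * \<mu> powr (- (?d * enn2real (1 / p))))"
      using \<rho> V B \<mu> r by (simp add: enn_powr_ennreal powr_mult powr_powr mult_ac)
    ultimately show ?thesis
      by simp
  qed
  then show ?thesis
    using that[of "(?V * \<rho> ^ ?d) powr (1 / ?r)"] V \<rho> by simp
qed

lemma Lp_norm_zero: "0 < p \<Longrightarrow> Lp_norm p (\<lambda>x::'a::euclidean_space. 0) = 0"
  by (simp add: Lp_norm_def esssup_const)

section \<open>Linear changes of variables\<close>

text \<open>
  The library theorem on linear images needs a well-ordered index type, so the two kinds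
  of matrices that occur, diagonal ones and shears, are treated directly.
\<close>

definition scaling :: "real^'n^'n \<Rightarrow> bool" where
  "scaling M \<longleftrightarrow> (\<forall>h \<in> borel_measurable borel.
     (\<integral>\<^sup>+ y. h y \<partial>lborel) = ennreal \<bar>det M\<bar> * (\<integral>\<^sup>+ z. h (M *v z) \<partial>lborel))"

lemma measurable_matrix_vector_mult [measurable (raw)]:
  fixes M :: "real^'n^'m"
  shows "f \<in> borel_measurable N \<Longrightarrow> (\<lambda>z. M *v f z) \<in> borel_measurable N"
  by (rule measurable_compose[OF _ borel_measurable_continuous_onI[OF linear_continuous_on]])
     (auto intro: linear_conv_bounded_linear[THEN iffD1])

lemma scaling_mult:
  assumes "scaling M" "scaling N" shows "scaling (M ** N)"
  unfolding scaling_def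
proof
  fix h :: "real^'a \<Rightarrow> ennreal" assume h [measurable]: "h \<in> borel_measurable borel"
  have "(\<integral>\<^sup>+ y. h y \<partial>lborel) = ennreal \<bar>det M\<bar> * (\<integral>\<^sup>+ z. h (M *v z) \<partial>lborel)"
    by (rule assms(1)[unfolded scaling_def, rule_format, OF h])
  also have "(\<integral>\<^sup>+ z. h (M *v z) \<partial>lborel) = ennreal \<bar>det N\<bar> * (\<integral>\<^sup>+ z. h (M *v (N *v z)) \<partial>lborel)"
    by (rule assms(2)[unfolded scaling_def, rule_format]) measurable
  finally show "(\<integral>\<^sup>+ y. h y \<partial>lborel) = ennreal \<bar>det (M ** N)\<bar> * (\<integral>\<^sup>+ z. h (M ** N *v z) \<partial>lborel)"
    by (simp only: det_mul abs_mult ennreal_mult[OF abs_ge_zero abs_ge_zero] mult.assoc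
        matrix_vector_mul_assoc[symmetric])
qed

lemma scaling_diagonal:
  fixes M :: "real^'n^'n"
  assumes diag: "\<And>i k. i \<noteq> k \<Longrightarrow> M $ i $ k = 0" and nz: "\<And>i. M $ i $ i \<noteq> 0"
  shows "scaling M"
  unfolding scaling_def
proof
  fix h :: "real^'n \<Rightarrow> ennreal" assume h [measurable]: "h \<in> borel_measurable borel"
  \<comment> \<open>The affine change of variables takes coefficients indexed by basis vectors; the
    description operator recovers the index i from \<open>axis i 1\<close>.\<close>
  define c where "c j = M $ (THE i. j = axis i (1::real)) $ (THE i. j = axis i (1::real))" for j
  have c [simp]: "c (axis i 1) = M $ i $ i" for i
    by (simp add: c_def axis_eq_axis)
  have Basis: "Basis = range (\<lambda>i::'n. axis i (1::real))"
    by (auto simp: Basis_vec_def)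
  have inj: "inj (\<lambda>i::'n. axis i (1::real))"
    by (auto simp: inj_def axis_eq_axis)
  have Mz: "M *v z = 0 + (\<Sum>j\<in>Basis. (c j * (z \<bullet> j)) *\<^sub>R j)" for z
  proof -
    have "(M *v z) $ k = M $ k $ k * z $ k" for k
      using diag by (simp add: matrix_vector_mult_def sum.remove[of UNIV k])
    moreover have "(\<Sum>j\<in>Basis. (c j * (z \<bullet> j)) *\<^sub>R j) = (\<Sum>i\<in>UNIV. (M $ i $ i * z $ i) *\<^sub>R axis i 1)"
      by (simp add: Basis sum.reindex[OF inj] inner_axis)
    moreover have "(\<Sum>i\<in>UNIV. (M $ i $ i * z $ i) *\<^sub>R axis i (1::real)) $ k = M $ k $ k * z $ k" for k
      by (simp add: sum_component axis_def if_distrib[of "\<lambda>a. _ * a"] cong: if_cong)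
    ultimately show ?thesis
      by (simp add: vec_eq_iff)
  qed
  have det: "(\<Prod>j\<in>Basis. \<bar>c j\<bar>) = \<bar>det M\<bar>"
    using diag by (simp add: Basis prod.reindex[OF inj] det_diagonal abs_prod)
  have "lborel = density (distr lborel borel (\<lambda>z. M *v z)) (\<lambda>_. ennreal \<bar>det M\<bar>)"
    unfolding Mz det[symmetric] by (rule lborel_affine_euclidean) (auto simp: Basis nz)
  then have "(\<integral>\<^sup>+ y. h y \<partial>lborel) = (\<integral>\<^sup>+ y. h y \<partial>density (distr lborel borel (\<lambda>z. M *v z)) (\<lambda>_. ennreal \<bar>det M\<bar>))"
    by simp
  also have "\<dots> = ennreal \<bar>det M\<bar> * (\<integral>\<^sup>+ z. h (M *v z) \<partial>lborel)"
    by (simp add: nn_integral_density nn_integral_distr nn_integral_cmult)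
  finally show "(\<integral>\<^sup>+ y. h y \<partial>lborel) = ennreal \<bar>det M\<bar> * (\<integral>\<^sup>+ z. h (M *v z) \<partial>lborel)" .
qed

text \<open>Integrate in the coordinate b first. With the other coordinates frozen, v \<bullet> x is
  constant because v \<bullet> b = 0, so the shear is a translation of the line.\<close>

lemma nn_integral_shear:
  fixes b v :: "'a::euclidean_space"
  assumes b: "b \<in> Basis" and v: "v \<bullet> b = 0" and [measurable]: "h \<in> borel_measurable borel"
  shows "(\<integral>\<^sup>+ x. h (x + (v \<bullet> x) *\<^sub>R b) \<partial>lborel) = (\<integral>\<^sup>+ x. h x \<partial>lborel)"
proof -
  interpret product_sigma_finite "\<lambda>_::'a. lborel :: real measure"
    by unfold_locales
  define J where "J = Basis - {b}"
  have J: "Basis = insert b J" "finite J" "b \<notin> J"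
    using b by (auto simp: J_def)
  have split: "(\<integral>\<^sup>+ x. k x \<partial>lborel)
      = (\<integral>\<^sup>+ y. \<integral>\<^sup>+ t. k ((\<Sum>j\<in>J. y j *\<^sub>R j) + t *\<^sub>R b) \<partial>lborel \<partial>Pi\<^sub>M J (\<lambda>_. lborel))"
    if [measurable]: "k \<in> borel_measurable borel" for k :: "'a \<Rightarrow> ennreal"
  proof -
    have "(\<integral>\<^sup>+ x. k x \<partial>lborel) = (\<integral>\<^sup>+ y. k (\<Sum>j\<in>insert b J. y j *\<^sub>R j) \<partial>Pi\<^sub>M (insert b J) (\<lambda>_. lborel))"
      unfolding J(1)[symmetric] by (subst lborel_eq) (simp add: nn_integral_distr)
    also have "\<dots> = (\<integral>\<^sup>+ y. \<integral>\<^sup>+ t. k (\<Sum>j\<in>insert b J. (y(b := t)) j *\<^sub>R j) \<partial>lborel \<partial>Pi\<^sub>M J (\<lambda>_. lborel))"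
      by (subst product_nn_integral_insert) (use J in auto)
    also have "\<dots> = (\<integral>\<^sup>+ y. \<integral>\<^sup>+ t. k ((\<Sum>j\<in>J. y j *\<^sub>R j) + t *\<^sub>R b) \<partial>lborel \<partial>Pi\<^sub>M J (\<lambda>_. lborel))"
    proof -
      have "(\<Sum>j\<in>insert b J. (y(b := t)) j *\<^sub>R j) = (\<Sum>j\<in>J. y j *\<^sub>R j) + t *\<^sub>R b" for y and t :: real
      proof -
        have eq: "(\<Sum>j\<in>J. (y(b := t)) j *\<^sub>R j) = (\<Sum>j\<in>J. y j *\<^sub>R j)"
          using J by (intro sum.cong) auto
        show ?thesis
          unfolding sum.insert[OF J(2,3)] eq by (simp add: add.commute)
      qed
      then show ?thesis
        by (simp only:)
    qed
    finally show ?thesis .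
  qed
  have inner: "(\<integral>\<^sup>+ t. h ((\<Sum>j\<in>J. y j *\<^sub>R j) + t *\<^sub>R b + (v \<bullet> ((\<Sum>j\<in>J. y j *\<^sub>R j) + t *\<^sub>R b)) *\<^sub>R b) \<partial>lborel)
      = (\<integral>\<^sup>+ t. h ((\<Sum>j\<in>J. y j *\<^sub>R j) + t *\<^sub>R b) \<partial>lborel)" for y
    using nn_integral_real_affine[of "\<lambda>t. h ((\<Sum>j\<in>J. y j *\<^sub>R j) + t *\<^sub>R b)" 1 "v \<bullet> (\<Sum>j\<in>J. y j *\<^sub>R j)"] v
    by (simp add: inner_add_right algebra_simps)
  show ?thesis
    by (simp add: split[of "\<lambda>x. h (x + (v \<bullet> x) *\<^sub>R b)"] split[of h] inner)
qed

text \<open>\<open>scaling\<close> only speaks of nonnegative integrands. As an identity of measures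
  it can also be applied to complex Bochner integrals. The reflection z \<mapsto> x - z preserves
  Lebesgue measure.\<close>

lemma lborel_scaling:
  fixes M :: "real^'n^'n"
  assumes "scaling M"
  shows "lborel = density (distr lborel borel (\<lambda>z. x - M *v z)) (\<lambda>_. ennreal \<bar>det M\<bar>)"
proof (rule measure_eqI)
  fix S :: "(real^'n) set" assume "S \<in> sets lborel"
  then have S [measurable]: "S \<in> sets borel"
    by simp
  have reflect: "(\<integral>\<^sup>+ y. indicator S y \<partial>lborel) = (\<integral>\<^sup>+ y. indicator S (x - y) \<partial>lborel)"
    by (subst lborel_affine[of "-1" x]) (auto simp: nn_integral_density nn_integral_distr)
  have "emeasure lborel S = (\<integral>\<^sup>+ y. indicator S y \<partial>lborel)"
    by simp
  also have "\<dots> = ennreal \<bar>det M\<bar> * (\<integral>\<^sup>+ z. indicator S (x - M *v z) \<partial>lborel)"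
    unfolding reflect by (rule assms[unfolded scaling_def, rule_format]) measurable
  also have "(\<integral>\<^sup>+ z. indicator S (x - M *v z) \<partial>lborel)
      = (\<integral>\<^sup>+ y. indicator S y \<partial>distr lborel borel (\<lambda>z. x - M *v z))"
    by (subst nn_integral_distr) auto
  also have "ennreal \<bar>det M\<bar> * \<dots>
      = emeasure (density (distr lborel borel (\<lambda>z. x - M *v z)) (\<lambda>_. ennreal \<bar>det M\<bar>)) S"
    by (subst emeasure_density) (simp_all add: nn_integral_cmult)
  finally show "emeasure lborel S = \<dots>" .
qed simp

lemma matrix_inv_cancel:
  fixes M :: "real^'n^'n"
  assumes "invertible M"
  shows "matrix_inv M ** M = mat 1" "M ** matrix_inv M = mat 1"
  using someI_ex[OF assms[unfolded invertible_def]] unfolding matrix_inv_def by auto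

text \<open>Substituting y = x - M z makes the Jacobian cancel the normalisation of the dilated
  kernel. The result has the shape of the pairings in \<open>band\<close>, with T z = x - M
  z.\<close>

lemma conv_distr_mat_dilate:
  fixes M :: "real^'n^'n" and f g :: "real^'n \<Rightarrow> complex"
  assumes M: "scaling M" "invertible M"
    and [measurable]: "f \<in> borel_measurable borel" "g \<in> borel_measurable borel"
  shows "conv_distr (distr_of f) (mat_dilate M g) x = (LINT z|lborel. f (x - M *v z) * g z)"
proof -
  have det: "\<bar>det M\<bar> \<noteq> 0"
    using M(2) by (simp add: invertible_det_nz)
  have inv: "matrix_inv M *v (M *v z) = z" for z
    by (simp add: matrix_vector_mul_assoc matrix_inv_cancel[OF M(2)])
  have "conv_distr (distr_of f) (mat_dilate M g) x
      = (LINT y|density (distr lborel borel (\<lambda>z. x - M *v z)) (\<lambda>_. ennreal \<bar>det M\<bar>).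
           f y * (of_real (inverse \<bar>det M\<bar>) * g (matrix_inv M *v (x - y))))"
    unfolding conv_distr_def distr_of_def mat_dilate_def lborel_scaling[OF M(1), symmetric] ..
  also have "\<dots> = (LINT z|lborel. \<bar>det M\<bar> *\<^sub>R (f (x - M *v z) * (of_real (inverse \<bar>det M\<bar>) * g z)))"
    by (simp add: integral_density integral_distr inv)
  also have "\<dots> = (LINT z|lborel. f (x - M *v z) * g z)"
    using det by (intro Bochner_Integration.integral_cong refl) (simp add: scaleR_conv_of_real)
  finally show ?thesis .
qed

section \<open>Schwartz functions and tempered functions\<close>

lemma smooth_imp_continuous_on:
  assumes "smooth f" shows "continuous_on UNIV f"
proof -
  have "iter_deriv [] f differentiable at x" for x
    using assms unfolding smooth_def by (metis empty_subsetI list.set(1))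
  then show ?thesis
    by (auto simp: continuous_on_eq_continuous_within intro: differentiable_imp_continuous_within)
qed

lemma schwartz_measurable: "schwartz f \<Longrightarrow> f \<in> borel_measurable borel"
  by (auto simp: schwartz_def intro: borel_measurable_continuous_onI smooth_imp_continuous_on)

text \<open>DIM + 1 of the available powers are spent on an integrable weight. The explicit bound,
  linear in C, is what later yields continuity of the induced distribution.\<close>

lemma integrable_weighted:
  fixes f :: "'a::euclidean_space \<Rightarrow> complex"
  assumes [measurable]: "f \<in> borel_measurable borel" and C: "C \<ge> 0"
    and le: "\<And>x. (1 + norm x) ^ (k + DIM('a) + 1) * norm (f x) \<le> C"
  shows "integrable lborel (\<lambda>x. (1 + norm x) ^ k * norm (f x))" (is ?I)
    and "(LINT x|lborel. (1 + norm x) ^ k * norm (f x))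
      \<le> C * (LINT x::'a|lborel. (1 + norm x) powr (- real (DIM('a) + 1)))"
proof -
  let ?w = "\<lambda>x::'a. (1 + norm x) powr (- real (DIM('a) + 1))"
  obtain D where "\<And>\<mu>. \<mu> > 0 \<Longrightarrow> (\<integral>\<^sup>+ (x::'a). ennreal ((1 + \<mu> * norm x) powr (- real (DIM('a) + 1))) \<partial>lborel)
      \<le> ennreal (D * \<mu> powr (- real DIM('a)))"
    by (rule nn_integral_decay_le[where 'a='a, of "real (DIM('a) + 1)"]) (simp, blast)
  from this[of 1] have "(\<integral>\<^sup>+ (x::'a). ennreal (?w x) \<partial>lborel) \<le> ennreal D"
    by simp
  then have w: "integrable lborel ?w"
    by (intro integrableI_bounded) (auto intro: le_less_trans)
  have pw: "(1 + norm x) ^ k * norm (f x) \<le> C * ?w x" for x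
  proof -
    have pos: "0 < 1 + norm x"
      by (simp add: add_pos_nonneg)
    have "((1 + norm x) ^ k * norm (f x)) * (1 + norm x) ^ (DIM('a) + 1) \<le> C"
      using le[of x] by (simp add: power_add mult_ac)
    moreover have "?w x = inverse ((1 + norm x) ^ (DIM('a) + 1))"
      using pos by (simp only: powr_minus powr_realpow)
    ultimately show ?thesis
      using zero_less_power[OF pos, of "DIM('a) + 1"]
      by (simp only: pos_le_divide_eq flip: divide_inverse)
  qed
  show I: ?I
    by (rule Bochner_Integration.integrable_bound[OF integrable_mult_right[OF w, of C]])
       (use pw C in \<open>auto simp: abs_mult\<close>)
  show "(LINT x|lborel. (1 + norm x) ^ k * norm (f x)) \<le> C * (LINT x|lborel. ?w x)"
    using integral_mono[OF I integrable_mult_right[OF w, of C] pw] by simp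
qed

lemma schwartz_bound:
  assumes "schwartz f"
  obtains C where "C \<ge> 0" "\<And>x. (1 + norm x) ^ k * norm (f x) \<le> C"
proof -
  have "bdd_above (range (\<lambda>x. (1 + norm x) ^ k * norm (iter_deriv [] f x)))"
    using assms unfolding schwartz_def by (metis empty_subsetI list.set(1))
  then obtain C where C: "\<And>x. (1 + norm x) ^ k * norm (f x) \<le> C"
    by (auto simp: bdd_above_def)
  moreover have "C \<ge> 0"
    by (rule order_trans[OF _ C[of 0]]) simp
  ultimately show ?thesis
    using that by blast
qed

lemma schwartz_integrable_weighted:
  assumes "schwartz f"
  shows "integrable lborel (\<lambda>x. (1 + norm x) ^ k * norm (f x))"
proof -
  obtain C where "C \<ge> 0" "\<And>x. (1 + norm x) ^ (k + DIM('a) + 1) * norm (f x) \<le> C"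
    using assms by (rule schwartz_bound) blast
  then show ?thesis
    using schwartz_measurable[OF assms] by (rule integrable_weighted(1)[rotated])
qed

lemma schwartz_integrable:
  assumes "schwartz f" shows "integrable lborel f"
  using schwartz_integrable_weighted[OF assms, of 0] schwartz_measurable[OF assms]
  by (simp add: integrable_norm_iff)

text \<open>A real-valued supremum bounds its terms only if the family is bounded above. Each
  derivative is bounded separately, and there are only finitely many words of length at most N over
  the basis.\<close>

lemma schwartz_norm_upper:
  fixes g :: "'a::euclidean_space \<Rightarrow> complex"
  assumes "schwartz g"
  shows "(1 + norm x) ^ N * norm (g x) \<le> schwartz_norm N g"
proof -
  define L where "L = {bs :: 'a list. set bs \<subseteq> Basis \<and> length bs \<le> N}"
  have "finite L"
    unfolding L_def by (rule finite_lists_length_le) simp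
  have "\<exists>B. \<forall>x. (1 + norm x) ^ N * norm (iter_deriv bs g x) \<le> B" if "bs \<in> L" for bs
    using assms that unfolding schwartz_def L_def bdd_above_def by blast
  then obtain B where B: "\<And>bs x. bs \<in> L \<Longrightarrow> (1 + norm x) ^ N * norm (iter_deriv bs g x) \<le> B bs"
    by metis
  have "bdd_above ((\<lambda>(bs, x). (1 + norm x) ^ N * norm (iter_deriv bs g x)) ` (L \<times> UNIV))"
  proof (rule bdd_aboveI2, clarify)
    fix bs and x :: 'a assume bs: "bs \<in> L"
    have "(1 + norm x) ^ N * norm (iter_deriv bs g x) \<le> \<bar>B bs\<bar>"
      using B[OF bs, of x] by linarith
    also have "\<dots> \<le> (\<Sum>bs\<in>L. \<bar>B bs\<bar>)"
      using bs \<open>finite L\<close> by (intro member_le_sum) auto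
    finally show "(1 + norm x) ^ N * norm (iter_deriv bs g x) \<le> (\<Sum>bs\<in>L. \<bar>B bs\<bar>)" .
  qed
  moreover have "([], x) \<in> L \<times> (UNIV :: 'a set)"
    by (simp add: L_def)
  ultimately have "(case ([], x) of (bs, x) \<Rightarrow> (1 + norm x) ^ N * norm (iter_deriv bs g x))
      \<le> (SUP (bs, x) \<in> L \<times> UNIV. (1 + norm x) ^ N * norm (iter_deriv bs g x))"
    by (intro cSUP_upper)
  then show ?thesis
    by (simp add: schwartz_norm_def L_def)
qed

text \<open>The pairing is at most B times the L^1 norm of the test function, which the Schwartz
  norm of order DIM + 1 controls.\<close>

lemma bounded_imp_tempered:
  fixes f :: "'a::euclidean_space \<Rightarrow> complex"
  assumes [measurable]: "f \<in> borel_measurable borel" and B: "\<And>x. norm (f x) \<le> B"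
  shows "tempered_function f" and "tempered_distribution (distr_of f)"
proof -
  have B0: "B \<ge> 0"
    using B[of 0] norm_ge_zero order_trans by blast
  have int: "integrable lborel (\<lambda>x. f x * g x)" if g: "schwartz g" for g
  proof (rule Bochner_Integration.integrable_bound)
    have [measurable]: "g \<in> borel_measurable borel"
      using g by (rule schwartz_measurable)
    show "integrable lborel (\<lambda>x. B * norm (g x))"
      using schwartz_integrable[OF g] by simp
    show "(\<lambda>x. f x * g x) \<in> borel_measurable lborel"
      by simp
    show "AE x in lborel. norm (f x * g x) \<le> norm (B * norm (g x))"
      using B B0 by (auto simp: norm_mult abs_mult intro!: mult_right_mono)
  qed
  then show "tempered_function f"
    by (simp add: tempered_function_def)
  let ?N = "DIM('a) + 1"
  define K where "K = (LINT x::'a|lborel. (1 + norm x) powr (- real ?N))"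
  have bound: "norm (distr_of f g) \<le> B * K * schwartz_norm ?N g" if g: "schwartz g" for g
  proof -
    have ig: "integrable lborel (\<lambda>x. B * norm (g x))"
      using schwartz_integrable[OF g] by simp
    have "norm (distr_of f g) \<le> (LINT x|lborel. norm (f x * g x))"
      unfolding distr_of_def by (rule integral_norm_bound)
    also have "\<dots> \<le> (LINT x|lborel. B * norm (g x))"
      using B by (intro integral_mono[OF integrable_norm[OF int[OF g]] ig])
         (auto simp: norm_mult intro!: mult_right_mono)
    also have "\<dots> = B * (LINT x|lborel. (1 + norm x) ^ 0 * norm (g x))"
      by simp
    also have "\<dots> \<le> B * (schwartz_norm ?N g * K)"
    proof (rule mult_left_mono[OF _ B0])
      have le: "(1 + norm x) ^ (0 + DIM('a) + 1) * norm (g x) \<le> schwartz_norm ?N g" for x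
        using schwartz_norm_upper[OF g, of x ?N] by simp
      have "0 \<le> schwartz_norm ?N g"
        by (rule order_trans[OF _ le[of 0]]) simp
      then show "(LINT x|lborel. (1 + norm x) ^ 0 * norm (g x)) \<le> schwartz_norm ?N g * K"
        unfolding K_def using integrable_weighted(2)[OF schwartz_measurable[OF g] _ le] by simp
    qed
    finally show ?thesis
      by (simp add: mult_ac)
  qed
  show "tempered_distribution (distr_of f)"
    unfolding tempered_distribution_def
  proof (intro conjI allI impI)
    fix g h :: "'a \<Rightarrow> complex" assume "schwartz g" "schwartz h"
    then show "distr_of f (\<lambda>x. g x + h x) = distr_of f g + distr_of f h"
      using int by (simp add: distr_of_def ring_distribs)
  next
    fix c and g :: "'a \<Rightarrow> complex"
    show "distr_of f (\<lambda>x. c * g x) = c * distr_of f g"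
      by (simp add: distr_of_def mult.left_commute)
  next
    show "\<exists>C N. \<forall>g. schwartz g \<longrightarrow> norm (distr_of f g) \<le> C * schwartz_norm N g"
      using bound by blast
  qed
qed

section \<open>Convolutions with wave packets\<close>

lemma bump_measurable [measurable]: "bump m \<xi> \<mu> \<in> borel_measurable borel"
  unfolding bump_def[abs_def] by measurable

lemma norm_bump_le_1: "norm (bump m \<xi> \<mu> x) \<le> 1"
  by (auto simp: bump_def norm_mult prod_norm[symmetric] norm_power
      intro!: prod_le_1 power_le_one norm_sinc_le_1)

text \<open>Plane waves are eigenfunctions of convolution. The eigenvalue is the transform of the
  dilated kernel at \<eta>, that is, the transform of g at the row vector \<eta> M.\<close>

lemma pairing_wave:
  fixes M :: "real^'n^'n"
  shows "(LINT z|lborel. wave \<eta> (x - M *v z) * g z) = wave \<eta> x * fourier g (\<eta> v* M)"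
proof -
  have "wave \<eta> (x - M *v z) = wave \<eta> x * wave (- (\<eta> v* M)) z" for z
    by (simp only: wave_diff_right) (simp add: wave_def dot_lmul_matrix)
  then show ?thesis
    by (simp add: fourier_wave mult.assoc)
qed

text \<open>The amplitude stays outside \<open>bump\<close> because \<open>band\<close> concerns
  functions bounded by 1.\<close>

definition packet :: "nat \<Rightarrow> real^'n \<Rightarrow> real \<Rightarrow> real \<Rightarrow> real^'n \<Rightarrow> complex" where
  "packet m \<xi> \<mu> c x = of_real c * bump m \<xi> \<mu> x"

lemma packet_tempered:
  "tempered_function (packet m \<xi> \<mu> c)" "tempered_distribution (distr_of (packet m \<xi> \<mu> c))"
proof -
  have "packet m \<xi> \<mu> c \<in> borel_measurable borel"
    unfolding packet_def by measurable
  moreover have "norm (packet m \<xi> \<mu> c x) \<le> \<bar>c\<bar>" for x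
    using norm_bump_le_1[of m \<xi> \<mu> x] by (simp add: packet_def norm_mult mult_left_le)
  ultimately show "tempered_function (packet m \<xi> \<mu> c)" "tempered_distribution (distr_of (packet m \<xi> \<mu> c))"
    by (blast intro: bounded_imp_tempered)+
qed

locale dilated_kernel =
  fixes M :: "real^'n^'n" and g :: "real^'n \<Rightarrow> complex" and \<mu> :: real
  assumes M: "scaling M" "invertible M" and g: "schwartz g" and \<mu>: "\<mu> > 0"
begin

lemma g_measurable [measurable]: "g \<in> borel_measurable borel"
  using g by (rule schwartz_measurable)

lemma conv_packet:
  "conv_distr (distr_of (packet m \<xi> \<mu> c)) (mat_dilate M g) x
     = of_real c * (LINT z|lborel. bump m \<xi> \<mu> (x - M *v z) * g z)"
proof -
  have "conv_distr (distr_of (packet m \<xi> \<mu> c)) (mat_dilate M g) x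
      = (LINT z|lborel. packet m \<xi> \<mu> c (x - M *v z) * g z)"
    unfolding packet_def by (rule conv_distr_mat_dilate[OF M]) measurable
  then show ?thesis
    by (simp add: packet_def mult.assoc)
qed

lemma conv_packet_measurable:
  "conv_distr (distr_of (packet m \<xi> \<mu> c)) (mat_dilate M g) \<in> borel_measurable borel"
  unfolding conv_packet[abs_def] by measurable

text \<open>Transfers an estimate on the eigenvalues over the spectrum to the convolution of the
  bump. With w = 0 and \<epsilon> = 0 it shows vanishing; with w nonzero it gives the lower bound
  near the centre.\<close>

lemma bump_pairing_near:
  assumes "\<And>\<eta>. \<eta> \<in> cball \<xi> (CARD('n) * m * \<mu>) \<Longrightarrow> norm (wave \<eta> x * fourier g (\<eta> v* M) - w) \<le> \<epsilon>"
  shows "norm ((LINT z|lborel. bump m \<xi> \<mu> (x - M *v z) * g z) - w) \<le> \<epsilon>"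
proof (rule bandD[where K = "cball \<xi> (CARD('n) * m * \<mu>)"])
  show "band (cball \<xi> (CARD('n) * m * \<mu>)) (bump m \<xi> \<mu>)"
    using band_bump[where \<mu>=\<mu> and \<xi>=\<xi> and m=m] \<mu> by simp
qed (use assms in \<open>auto simp: pairing_wave schwartz_integrable[OF g]\<close>)

lemma Lp_norm_conv_packet_zero:
  assumes "0 < p" "\<And>\<eta>. \<eta> \<in> cball \<xi> (CARD('n) * m * \<mu>) \<Longrightarrow> fourier g (\<eta> v* M) = 0"
  shows "Lp_norm p (conv_distr (distr_of (packet m \<xi> \<mu> c)) (mat_dilate M g)) = 0"
proof -
  have "(LINT z|lborel. bump m \<xi> \<mu> (x - M *v z) * g z) = 0" for x
    using bump_pairing_near[where \<xi>=\<xi> and m=m and x=x and w=0 and \<epsilon>=0] assms(2) by simp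
  then show ?thesis
    by (simp add: conv_packet[abs_def] Lp_norm_zero assms(1))
qed

text \<open>Close to the origin all plane waves of the spectrum differ by at most 1/4 from the
  central one. Together with the deviation |w|/4 of the transform this costs |w|/2, leaving half of
  |w|.\<close>

lemma conv_packet_ge:
  assumes w: "\<And>\<eta>. \<eta> \<in> cball \<xi> (CARD('n) * m * \<mu>) \<Longrightarrow> norm (fourier g (\<eta> v* M) - w) \<le> norm w / 4"
    and x: "2 * pi * (CARD('n) * m * \<mu>) * norm x \<le> 1 / 4" and c: "c \<ge> 0"
  shows "c * (norm w / 2) \<le> norm (conv_distr (distr_of (packet m \<xi> \<mu> c)) (mat_dilate M g) x)"
proof -
  have "norm ((LINT z|lborel. bump m \<xi> \<mu> (x - M *v z) * g z) - wave \<xi> x * w) \<le> norm w / 2"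
  proof (rule bump_pairing_near)
    fix \<eta> assume \<eta>: "\<eta> \<in> cball \<xi> (CARD('n) * m * \<mu>)"
    have "norm (wave \<eta> x - wave \<xi> x) \<le> 2 * pi * norm (\<eta> - \<xi>) * norm x"
      by (rule norm_wave_diff_le)
    also have "\<dots> \<le> 2 * pi * (CARD('n) * m * \<mu>) * norm x"
      using \<eta> by (intro mult_right_mono mult_left_mono) (auto simp: dist_norm norm_minus_commute)
    finally have le: "norm (wave \<eta> x - wave \<xi> x) \<le> 1 / 4"
      using x by linarith
    have "wave \<eta> x * fourier g (\<eta> v* M) - wave \<xi> x * w
        = wave \<eta> x * (fourier g (\<eta> v* M) - w) + (wave \<eta> x - wave \<xi> x) * w"
      by (simp add: algebra_simps)
    also have "norm \<dots> \<le> norm (fourier g (\<eta> v* M) - w) + norm (wave \<eta> x - wave \<xi> x) * norm w"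
      by (rule order_trans[OF norm_triangle_ineq]) (simp add: norm_mult)
    also have "\<dots> \<le> norm w / 4 + 1 / 4 * norm w"
      by (intro add_mono w[OF \<eta>] mult_right_mono le) simp
    finally show "norm (wave \<eta> x * fourier g (\<eta> v* M) - wave \<xi> x * w) \<le> norm w / 2"
      by simp
  qed
  then have "norm w / 2 \<le> norm (LINT z|lborel. bump m \<xi> \<mu> (x - M *v z) * g z)"
    using norm_triangle_ineq2[of "wave \<xi> x * w" "LINT z|lborel. bump m \<xi> \<mu> (x - M *v z) * g z"]
    by (simp add: norm_mult norm_minus_commute)
  from mult_left_mono[OF this c] show ?thesis
    using c by (simp add: conv_packet norm_mult)
qed

text \<open>A Peetre-type inequality: 1 + \<mu> |x| is at most (1 + \<mu> |x - M z|) (1 + \<kappa>)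
  (1 + |z|), so decay passes from the bump to the convolution and the Schwartz kernel absorbs the
  weight in z. The number \<kappa> compares the width of the dilated kernel with the width 1/\<mu>
  of the packet.\<close>

lemma conv_packet_le:
  assumes \<kappa>: "\<kappa> \<ge> 0" "\<And>z. \<mu> * norm (M *v z) \<le> \<kappa> * norm z" and c: "c \<ge> 0"
  shows "norm (conv_distr (distr_of (packet m \<xi> \<mu> c)) (mat_dilate M g) x)
    \<le> c * (2 ^ (CARD('n) * m) * (1 + \<kappa>) ^ m * (LINT z|lborel. (1 + norm z) ^ m * norm (g z)))
        / (1 + \<mu> * norm x) ^ m"
proof -
  let ?D = "2 ^ (CARD('n) * m) * (1 + \<kappa>) ^ m / (1 + \<mu> * norm x) ^ m"
  have pos: "0 < 1 + \<mu> * norm y" for y :: "real^'n"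
    using \<mu> by (simp add: add_pos_nonneg)
  have wint: "integrable lborel (\<lambda>z. ?D * ((1 + norm z) ^ m * norm (g z)))"
    using schwartz_integrable_weighted[OF g] by simp
  have pw: "norm (bump m \<xi> \<mu> (x - M *v z) * g z) \<le> ?D * ((1 + norm z) ^ m * norm (g z))" for z
  proof -
    let ?y = "x - M *v z"
    have "1 + \<mu> * norm x \<le> 1 + \<mu> * (norm ?y + norm (M *v z))"
      using \<mu> norm_triangle_ineq[of ?y "M *v z"] by simp
    also have "\<dots> \<le> 1 + \<mu> * norm ?y + \<kappa> * norm z"
      using \<kappa>(2)[of z] by (simp add: algebra_simps)
    also have "\<dots> \<le> (1 + \<mu> * norm ?y) * ((1 + \<kappa>) * (1 + norm z))"
    proof -
      have "1 + \<kappa> * norm z \<le> (1 + \<kappa>) * (1 + norm z)"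
        using \<kappa>(1) by (simp add: algebra_simps)
      moreover have "1 + \<mu> * norm ?y + \<kappa> * norm z \<le> (1 + \<mu> * norm ?y) * (1 + \<kappa> * norm z)"
        using \<kappa>(1) \<mu> by (simp add: algebra_simps)
      ultimately show ?thesis
        using mult_left_mono[OF _ less_imp_le[OF pos[of ?y]]] order_trans by blast
    qed
    finally have "(1 + \<mu> * norm x) ^ m \<le> ((1 + \<mu> * norm ?y) * ((1 + \<kappa>) * (1 + norm z))) ^ m"
      using pos[of x] by (intro power_mono) auto
    then have "1 / (1 + \<mu> * norm ?y) ^ m \<le> (1 + \<kappa>) ^ m * (1 + norm z) ^ m / (1 + \<mu> * norm x) ^ m"
      using zero_less_power[OF pos[of x], of m] zero_less_power[OF pos[of ?y], of m]
      by (simp add: power_mult_distrib pos_le_divide_eq pos_divide_le_eq mult_ac)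
    then have "2 ^ (CARD('n) * m) * (1 / (1 + \<mu> * norm ?y) ^ m)
        \<le> 2 ^ (CARD('n) * m) * ((1 + \<kappa>) ^ m * (1 + norm z) ^ m / (1 + \<mu> * norm x) ^ m)"
      by (intro mult_left_mono) auto
    moreover have "norm (bump m \<xi> \<mu> ?y) \<le> 2 ^ (CARD('n) * m) * (1 / (1 + \<mu> * norm ?y) ^ m)"
      using bump_decay[where \<mu>=\<mu> and \<xi>=\<xi> and m=m and x="?y"] \<mu> by simp
    ultimately have "norm (bump m \<xi> \<mu> ?y) \<le> ?D * (1 + norm z) ^ m"
      by (simp add: mult_ac)
    from mult_right_mono[OF this, of "norm (g z)"] show ?thesis
      by (simp add: norm_mult mult.assoc)
  qed
  have int: "integrable lborel (\<lambda>z. norm (bump m \<xi> \<mu> (x - M *v z) * g z))"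
  proof (rule Bochner_Integration.integrable_bound[OF wint])
    show "AE z in lborel. norm (norm (bump m \<xi> \<mu> (x - M *v z) * g z))
        \<le> norm (?D * ((1 + norm z) ^ m * norm (g z)))"
      unfolding real_norm_def abs_norm_cancel by (intro AE_I2 order_trans[OF pw abs_ge_self])
  qed measurable
  have "norm (LINT z|lborel. bump m \<xi> \<mu> (x - M *v z) * g z)
      \<le> (LINT z|lborel. norm (bump m \<xi> \<mu> (x - M *v z) * g z))"
    by (rule integral_norm_bound)
  also have "\<dots> \<le> (LINT z|lborel. ?D * ((1 + norm z) ^ m * norm (g z)))"
    by (rule integral_mono[OF int wint pw])
  also have "\<dots> = ?D * (LINT z|lborel. (1 + norm z) ^ m * norm (g z))"
    by (rule integral_mult_right_zero)
  finally have "c * norm (LINT z|lborel. bump m \<xi> \<mu> (x - M *v z) * g z)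
      \<le> c * (?D * (LINT z|lborel. (1 + norm z) ^ m * norm (g z)))"
    using c by (rule mult_left_mono)
  then show ?thesis
    using c by (simp add: conv_packet norm_mult mult_ac)
qed

end

lemma Lp_norm_conv_packet_le:
  fixes g :: "real^'n \<Rightarrow> complex"
  assumes p: "0 < p" "CARD('n) * enn2real (1 / p) < real m" and g: "schwartz g" and \<kappa>: "\<kappa> \<ge> 0"
  obtains C where "C > 0" "\<And>M \<xi> (\<mu>::real) (c::real). scaling M \<Longrightarrow> invertible M \<Longrightarrow> \<mu> > 0 \<Longrightarrow> c \<ge> 0 \<Longrightarrow>
      (\<And>z. \<mu> * norm (M *v z) \<le> \<kappa> * norm z) \<Longrightarrow>
      Lp_norm p (conv_distr (distr_of (packet m \<xi> \<mu> c)) (mat_dilate M g))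
        \<le> ennreal (C * c * \<mu> powr (- (CARD('n) * enn2real (1 / p))))"
proof -
  let ?e = "CARD('n) * enn2real (1 / p)"
  obtain C where C: "C > 0" "\<And>(h::real^'n \<Rightarrow> complex) \<mu> B. h \<in> borel_measurable borel \<Longrightarrow> \<mu> > 0 \<Longrightarrow> B \<ge> 0 \<Longrightarrow>
    (\<And>x. norm (h x) \<le> B / (1 + \<mu> * norm x) ^ m) \<Longrightarrow> Lp_norm p h \<le> ennreal (C * B * \<mu> powr (- ?e))"
    using Lp_norm_le[where 'a="real^'n", OF p(1), of m] p(2) by (auto simp: mult.assoc)
  define I where "I = 2 ^ (CARD('n) * m) * (1 + \<kappa>) ^ m * (LINT z|lborel. (1 + norm z) ^ m * norm (g z))"
  have I: "I \<ge> 0"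
    using \<kappa> by (simp add: I_def)
  show ?thesis
  \<comment> \<open>\<open>I + 1\<close> instead of \<open>I\<close> keeps the constant positive
    even when the weighted integral of g is 0.\<close>
  proof (rule that[of "C * (I + 1)"])
    show "C * (I + 1) > 0"
      using C(1) I by simp
    fix M :: "real^'n^'n" and \<xi> :: "real^'n" and \<mu> c :: real
    assume *: "scaling M" "invertible M" "\<mu> > 0" "c \<ge> 0" "\<And>z. \<mu> * norm (M *v z) \<le> \<kappa> * norm z"
    then interpret dilated_kernel M g \<mu>
      using g by unfold_locales
    have "Lp_norm p (conv_distr (distr_of (packet m \<xi> \<mu> c)) (mat_dilate M g)) \<le> ennreal (C * (c * I) * \<mu> powr (- ?e))"
      using I * conv_packet_le[OF \<kappa> *(5,4)] by (intro C(2) conv_packet_measurable) (auto simp: I_def)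
    also have "\<dots> \<le> ennreal (C * (I + 1) * c * \<mu> powr (- ?e))"
      using C(1) I * by (intro ennreal_leI mult_right_mono) (auto simp: algebra_simps)
    finally show "Lp_norm p (conv_distr (distr_of (packet m \<xi> \<mu> c)) (mat_dilate M g))
        \<le> ennreal (C * (I + 1) * c * \<mu> powr (- ?e))" .
  qed
qed

lemma Lp_norm_conv_packet_ge:
  fixes g :: "real^'n \<Rightarrow> complex"
  assumes p: "0 < p" and g: "schwartz g" and w: "w \<noteq> 0"
  obtains C where "C > 0" "\<And>M \<xi> (\<mu>::real) (c::real). scaling M \<Longrightarrow> invertible M \<Longrightarrow> \<mu> > 0 \<Longrightarrow> c \<ge> 0 \<Longrightarrow>
      (\<And>\<eta>. \<eta> \<in> cball \<xi> (CARD('n) * m * \<mu>) \<Longrightarrow> norm (fourier g (\<eta> v* M) - w) \<le> norm w / 4) \<Longrightarrow>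
      ennreal (C * c * \<mu> powr (- (CARD('n) * enn2real (1 / p))))
        \<le> Lp_norm p (conv_distr (distr_of (packet m \<xi> \<mu> c)) (mat_dilate M g))"
proof -
  let ?e = "CARD('n) * enn2real (1 / p)"
  \<comment> \<open>Chosen so that \<mu> |x| \<le> \<rho> implies the closeness condition with 1/4
    in \<open>conv_packet_ge\<close>; the summand 1 keeps the denominator positive for m =
    0.\<close>
  define \<rho> where "\<rho> = 1 / (8 * pi * (CARD('n) * m + 1))"
  have pos: "CARD('n) * m + 1 > (0::real)"
    by (metis of_nat_0_less_iff zero_less_Suc Suc_eq_plus1)
  then have \<rho>: "\<rho> > 0"
    by (simp add: \<rho>_def)
  obtain C where C: "C > 0" "\<And>(h::real^'n \<Rightarrow> complex) \<mu> B. \<mu> > 0 \<Longrightarrow> B \<ge> 0 \<Longrightarrow>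
    (\<And>x. \<mu> * norm x \<le> \<rho> \<Longrightarrow> B \<le> norm (h x)) \<Longrightarrow> ennreal (C * B * \<mu> powr (- ?e)) \<le> Lp_norm p h"
    using Lp_norm_ge[where 'a="real^'n", OF p \<rho>] by (auto simp: mult.assoc)
  show ?thesis
  proof (rule that[of "C * (norm w / 2)"])
    show "C * (norm w / 2) > 0"
      using C(1) w by simp
    fix M :: "real^'n^'n" and \<xi> :: "real^'n" and \<mu> c :: real
    assume *: "scaling M" "invertible M" "\<mu> > 0" "c \<ge> 0"
      "\<And>\<eta>. \<eta> \<in> cball \<xi> (CARD('n) * m * \<mu>) \<Longrightarrow> norm (fourier g (\<eta> v* M) - w) \<le> norm w / 4"
    then interpret dilated_kernel M g \<mu>
      using g by unfold_locales
    have "c * (norm w / 2) \<le> norm (conv_distr (distr_of (packet m \<xi> \<mu> c)) (mat_dilate M g) x)"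
      if x: "\<mu> * norm x \<le> \<rho>" for x
    proof (rule conv_packet_ge)
      have "2 * pi * (CARD('n) * m * \<mu>) * norm x = 2 * pi * (CARD('n) * m) * (\<mu> * norm x)"
        by simp
      also have "\<dots> \<le> 2 * pi * (CARD('n) * m + 1) * \<rho>"
        using x \<rho> *(3) by (intro mult_mono) auto
      also have "\<dots> = 1 / 4"
        using pos by (simp add: \<rho>_def)
      finally show "2 * pi * (CARD('n) * m * \<mu>) * norm x \<le> 1 / 4" .
    qed (use * in auto)
    then have "ennreal (C * (c * (norm w / 2)) * \<mu> powr (- ?e)) \<le> Lp_norm p (conv_distr (distr_of (packet m \<xi> \<mu> c)) (mat_dilate M g))"
      using *(4) by (intro C(2)[OF *(3)]) auto
    then show "ennreal (C * (norm w / 2) * c * \<mu> powr (- ?e)) \<le> Lp_norm p (conv_distr (distr_of (packet m \<xi> \<mu> c)) (mat_dilate M g))"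
      by (simp add: mult_ac)
  qed
qed

section \<open>Dilation matrices\<close>

lemma matrix_inv_unique:
  fixes M :: "real^'n^'n"
  assumes "M ** N = mat 1" "N ** M = mat 1"
  shows "matrix_inv M = N"
proof -
  have "invertible M"
    using assms by (auto simp: invertible_def)
  then have "matrix_inv M ** (M ** N) = N"
    by (simp add: matrix_mul_assoc matrix_inv_cancel)
  then show ?thesis
    by (simp add: assms)
qed

definition diag_mat :: "('n \<Rightarrow> real) \<Rightarrow> real^'n^'n" where
  "diag_mat c = (\<chi> i k. if i = k then c i else 0)"

lemma diag_mat_mult: "diag_mat c ** N = (\<chi> i k. c i * N $ i $ k)"
  by (simp add: diag_mat_def matrix_matrix_mult_def vec_eq_iff if_distrib[of "\<lambda>a. a * _"] cong: if_cong)

lemma diag_mat_mult_diag_mat: "diag_mat c ** diag_mat e = diag_mat (\<lambda>i. c i * e i)"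
  by (simp add: diag_mat_mult) (simp add: diag_mat_def vec_eq_iff)

lemma diag_mat_one: "diag_mat (\<lambda>i. 1) = mat 1"
  by (simp add: diag_mat_def mat_def)

lemma matrix_inv_diag_mat:
  assumes "\<And>i. c i \<noteq> 0"
  shows "matrix_inv (diag_mat c) = diag_mat (\<lambda>i. inverse (c i))"
  using assms by (intro matrix_inv_unique) (simp_all add: diag_mat_mult_diag_mat diag_mat_one)

lemma det_diag_mat: "det (diag_mat c) = (\<Prod>i\<in>UNIV. c i)"
  by (simp add: det_diagonal diag_mat_def)

lemma scaling_diag_mat: "(\<And>i. c i \<noteq> 0) \<Longrightarrow> scaling (diag_mat c)"
  by (rule scaling_diagonal) (simp_all add: diag_mat_def)

lemma diag_mat_vector: "(diag_mat c *v z) $ i = c i * z $ i"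
  by (simp add: diag_mat_def matrix_vector_mult_def if_distrib[of "\<lambda>a. a * _"] cong: if_cong)

lemma vector_diag_mat: "(x v* diag_mat c) $ i = c i * x $ i"
  by (simp add: diag_mat_def vector_matrix_mult_def if_distrib[of "\<lambda>a. _ * a"] cong: if_cong)

lemma mat_pow_A_mat: "mat_pow (A_mat \<dd>) j = diag_mat (\<lambda>i. (if i = \<dd> then 4 else 2) ^ j)"
proof (induction j)
  case (Suc j)
  have "A_mat \<dd> = diag_mat (\<lambda>i. if i = \<dd> then 4 else 2)"
    by (simp add: A_mat_def diag_mat_def)
  with Suc show ?case
    by (simp add: diag_mat_mult_diag_mat cong: if_cong)
qed (simp add: diag_mat_one)

lemma shear_mat_eq:
  "shear_mat \<dd> j l = diag_mat (\<lambda>i. inverse ((if i = \<dd> then 4 else 2) ^ j)) ** B_mat \<dd> (- l)"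
  by (simp add: shear_mat_def mat_pow_A_mat matrix_inv_diag_mat)

text \<open>The form needed by \<open>nn_integral_shear\<close>: a multiple of one basis vector is
  added, and the coefficient vector vanishes in that coordinate.\<close>

lemma B_mat_vector: "B_mat \<dd> l *v z = z + ((\<chi> k. if k = \<dd> then 0 else real_of_int (l $ k)) \<bullet> z) *\<^sub>R axis \<dd> 1"
proof -
  let ?v = "\<chi> k. if k = \<dd> then 0 else real_of_int (l $ k)"
  have "(B_mat \<dd> l *v z) $ i = z $ i + (if i = \<dd> then ?v \<bullet> z else 0)" for i
  proof (cases "i = \<dd>")
    case True
    have "(B_mat \<dd> l *v z) $ \<dd> = (\<Sum>k\<in>UNIV. (if k = \<dd> then z $ k else 0) + ?v $ k * z $ k)"
      unfolding B_mat_def matrix_vector_mult_def vec_lambda_beta by (intro sum.cong) auto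
    then show ?thesis
      using True by (simp add: sum.distrib inner_vec_def)
  next
    case False
    then have "(B_mat \<dd> l *v z) $ i = (\<Sum>k\<in>UNIV. if i = k then z $ k else 0)"
      unfolding B_mat_def matrix_vector_mult_def vec_lambda_beta by (intro sum.cong) auto
    then show ?thesis
      using False by simp
  qed
  then show ?thesis
    by (simp add: vec_eq_iff axis_def)
qed

text \<open>The matrix arises from the identity by adding to one row a combination of the other
  rows.\<close>

lemma det_B_mat: "det (B_mat \<dd> l) = 1"
proof -
  let ?v = "\<chi> k. if k = \<dd> then 0 else real_of_int (l $ k)"
  have row: "row j (mat 1 :: real^'a^'a) = axis j 1" for j
    by (simp add: row_def mat_def axis_def vec_eq_iff)
  have "?v = (\<Sum>k\<in>UNIV - {\<dd>}. real_of_int (l $ k) *s axis k 1)"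
    by (simp add: vec_eq_iff axis_def sum_component if_distrib[of "\<lambda>a. _ * a"] cong: if_cong)
  also have "\<dots> \<in> vec.span {row j (mat 1 :: real^'a^'a) | j. j \<noteq> \<dd>}"
    by (intro vec.span_sum vec.span_scale vec.span_base) (auto simp: row)
  finally have "det (\<chi> k. if k = \<dd> then row \<dd> (mat 1 :: real^'a^'a) + ?v else row k (mat 1)) = 1"
    by (subst det_row_span) auto
  also have "(\<chi> k. if k = \<dd> then row \<dd> (mat 1 :: real^'a^'a) + ?v else row k (mat 1)) = B_mat \<dd> l"
    by (auto simp: row B_mat_def vec_eq_iff axis_def)
  finally show ?thesis .
qed

lemma scaling_B_mat: "scaling (B_mat \<dd> l)"
  unfolding scaling_def
proof
  fix h :: "real^'a \<Rightarrow> ennreal" assume h: "h \<in> borel_measurable borel"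
  show "(\<integral>\<^sup>+ y. h y \<partial>lborel) = ennreal \<bar>det (B_mat \<dd> l)\<bar> * (\<integral>\<^sup>+ z. h (B_mat \<dd> l *v z) \<partial>lborel)"
    unfolding B_mat_vector det_B_mat by (subst nn_integral_shear) (use h in \<open>auto simp: inner_axis\<close>)
qed

lemma scaling_shear_mat: "scaling (shear_mat \<dd> j l)"
  unfolding shear_mat_eq by (intro scaling_mult scaling_diag_mat scaling_B_mat) simp

lemma invertible_shear_mat: "invertible (shear_mat \<dd> j l)"
  by (simp add: invertible_det_nz shear_mat_eq det_mul det_B_mat det_diag_mat)

lemma vector_shear_mat:
  "(x v* shear_mat \<dd> j l) $ k
     = (if k = \<dd> then x $ \<dd> / 4 ^ j else x $ k / 2 ^ j - real_of_int (l $ k) * (x $ \<dd> / 4 ^ j))"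
proof -
  have "(x v* shear_mat \<dd> j l) $ k = (\<Sum>i\<in>UNIV.
      (if i = k then x $ i / (if i = \<dd> then 4 else 2) ^ j else 0)
      + (if i = \<dd> then (if k = \<dd> then 0 else - real_of_int (l $ k) * (x $ \<dd> / 4 ^ j)) else 0))"
    unfolding shear_mat_eq diag_mat_mult vector_matrix_mult_def B_mat_def vec_lambda_beta
    by (intro sum.cong) (auto simp: field_simps)
  then show ?thesis
    by (simp add: sum.distrib)
qed

text \<open>The diagonal factor contracts by at least 2^j, and a shear with entries at most 2 costs
  a constant; the dimension factors come from passing through the l1 norm. This supplies \<kappa> in
  \<open>conv_packet_le\<close> for the shearlets that the packet meets.\<close>

lemma norm_shear_mat_le:
  fixes z :: "real^'n"
  assumes l: "\<And>i. \<bar>l $ i\<bar> \<le> 2"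
  shows "2 ^ j * norm (shear_mat \<dd> j l *v z) \<le> CARD('n) * (1 + 2 * CARD('n)) * norm z"
proof -
  let ?v = "\<chi> k. if k = \<dd> then 0 else real_of_int ((- l) $ k)"
  let ?B = "B_mat \<dd> (- l) *v z"
  have v: "\<bar>?v \<bullet> z\<bar> \<le> 2 * CARD('n) * norm z"
  proof -
    have "\<bar>real_of_int (l $ k)\<bar> \<le> 2" for k
      using l[of k] by linarith
    then have "\<bar>?v $ k\<bar> \<le> 2" for k
      by simp
    then have "norm ?v \<le> (\<Sum>k\<in>(UNIV::'n set). (2::real))"
      by (intro order_trans[OF norm_le_l1_cart] sum_mono)
    then have "norm ?v * norm z \<le> 2 * CARD('n) * norm z"
      by (intro mult_right_mono) auto
    then show ?thesis
      using Cauchy_Schwarz_ineq2[of ?v z] by linarith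
  qed
  have B: "norm ?B \<le> (1 + 2 * CARD('n)) * norm z"
  proof -
    have "norm ?B \<le> norm z + \<bar>?v \<bullet> z\<bar>"
      unfolding B_mat_vector by (rule order_trans[OF norm_triangle_ineq]) simp
    then show ?thesis
      using v by (simp add: algebra_simps)
  qed
  have "\<bar>(shear_mat \<dd> j l *v z) $ i\<bar> \<le> norm ?B / 2 ^ j" for i
  proof -
    have "\<bar>(shear_mat \<dd> j l *v z) $ i\<bar> = \<bar>?B $ i\<bar> / (if i = \<dd> then 4 else 2) ^ j"
      by (simp add: shear_mat_eq diag_mat_vector abs_mult divide_inverse_commute flip: matrix_vector_mul_assoc)
    also have "\<dots> \<le> norm ?B / 2 ^ j"
      using component_le_norm_cart[of ?B i] by (intro frac_le power_mono) auto
    finally show ?thesis .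
  qed
  then have "norm (shear_mat \<dd> j l *v z) \<le> (\<Sum>i\<in>(UNIV::'n set). norm ?B / 2 ^ j)"
    by (intro order_trans[OF norm_le_l1_cart] sum_mono)
  then have "2 ^ j * norm (shear_mat \<dd> j l *v z) \<le> CARD('n) * norm ?B"
    by (simp add: field_simps)
  also have "\<dots> \<le> CARD('n) * ((1 + 2 * CARD('n)) * norm z)"
    using B by (intro mult_left_mono) auto
  finally show ?thesis
    by (simp add: algebra_simps)
qed

text \<open>Puts the isotropic system into the same form as the shearlets, so that one set of
  convolution estimates serves both quasi-norms.\<close>

lemma dyadic_dilate_eq:
  "dyadic_dilate \<nu> \<phi> = mat_dilate (diag_mat (\<lambda>i::'n. 1 / 2 ^ \<nu>)) (\<phi> :: real^'n \<Rightarrow> complex)"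
proof
  fix x :: "real^'n"
  have "matrix_inv (diag_mat (\<lambda>i. 1 / 2 ^ \<nu>)) *v x = 2 ^ \<nu> *\<^sub>R x"
    by (simp add: matrix_inv_diag_mat vec_eq_iff diag_mat_vector)
  then show "dyadic_dilate \<nu> \<phi> x = mat_dilate (diag_mat (\<lambda>i::'n. 1 / 2 ^ \<nu>)) \<phi> x"
    by (simp add: dyadic_dilate_def mat_dilate_def det_diag_mat power_one_over mult.commute power_mult
        inverse_eq_divide power_divide flip: power_inverse)
qed

lemma dyadic_dilate_0: "dyadic_dilate 0 \<phi> = \<phi>"
  by (simp add: dyadic_dilate_def fun_eq_iff)

section \<open>Frequency localisation\<close>

lemma in_supp: "f x \<noteq> 0 \<Longrightarrow> x \<in> supp f"
  unfolding supp_def by (rule subsetD[OF closure_subset]) simp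

text \<open>For a nonzero coordinate x_\<dd> the argument of \<open>h2\<close> is 2^j x_i / x_\<dd>
  - l_i. The quotient is left uncancelled because the two expressions differ under division by
  zero.\<close>

lemma shearlet_hat_shear_mat:
  "shearlet_hat h1 h2 \<dd> (x v* shear_mat \<dd> j l) = h1 (x $ \<dd> / 4 ^ j) *
     (\<Prod>i\<in>UNIV - {\<dd>}. h2 ((x $ i / 2 ^ j - real_of_int (l $ i) * (x $ \<dd> / 4 ^ j)) / (x $ \<dd> / 4 ^ j)))"
  by (simp add: shearlet_hat_def vector_shear_mat)

text \<open>One frequency \<eta> of the packet of index j. The interval for a is the positive part
  of the allowed support of \<open>h1\<close>; the bound 1/128 is what \<open>shear_freq\<close>
  needs to keep the slopes, enlarged by a scale change of 2, at most 1.\<close>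

locale packet_freq =
  fixes \<dd> :: "'n::finite" and a \<rho> :: real and j :: nat and \<eta> :: "real^'n"
  assumes a: "1 / 16 \<le> a" "a \<le> 1 / 2" and \<rho>: "0 < \<rho>" "\<rho> \<le> 1 / 128"
    and \<eta>: "\<eta> \<in> cball ((4 ^ j * a) *\<^sub>R axis \<dd> 1) (\<rho> * 2 ^ j)"
begin

lemma comp_dd: "\<bar>\<eta> $ \<dd> / 4 ^ j - a\<bar> \<le> \<rho>"
proof -
  have "\<bar>\<eta> $ \<dd> - 4 ^ j * a\<bar> = \<bar>(\<eta> - (4 ^ j * a) *\<^sub>R axis \<dd> 1) $ \<dd>\<bar>"
    by (simp add: axis_def)
  also have "\<dots> \<le> norm (\<eta> - (4 ^ j * a) *\<^sub>R axis \<dd> 1)"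
    by (rule component_le_norm_cart)
  also have "\<dots> \<le> \<rho> * 2 ^ j"
    using \<eta> by (simp add: dist_norm norm_minus_commute)
  also have "\<dots> \<le> \<rho> * 4 ^ j"
    using \<rho> by (intro mult_left_mono power_mono) auto
  finally have "\<bar>\<eta> $ \<dd> - 4 ^ j * a\<bar> / 4 ^ j \<le> \<rho>"
    by (simp add: field_simps)
  moreover have "\<eta> $ \<dd> / 4 ^ j - a = (\<eta> $ \<dd> - 4 ^ j * a) / 4 ^ j"
    by (simp add: field_simps)
  ultimately show ?thesis
    by (simp add: abs_divide)
qed

lemma comp_dd_bounds: "4 ^ j / 32 \<le> \<eta> $ \<dd>" "\<eta> $ \<dd> \<le> 4 ^ j"
proof -
  have "1 / 32 \<le> \<eta> $ \<dd> / 4 ^ j" "\<eta> $ \<dd> / 4 ^ j \<le> 1"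
    using comp_dd a \<rho> by linarith+
  then show "4 ^ j / 32 \<le> \<eta> $ \<dd>" "\<eta> $ \<dd> \<le> 4 ^ j"
    by (simp_all add: field_simps)
qed

lemma comp_other: "i \<noteq> \<dd> \<Longrightarrow> \<bar>\<eta> $ i\<bar> \<le> \<rho> * 2 ^ j"
proof -
  assume "i \<noteq> \<dd>"
  then have "\<bar>\<eta> $ i\<bar> = \<bar>(\<eta> - (4 ^ j * a) *\<^sub>R axis \<dd> 1) $ i\<bar>"
    by (simp add: axis_def)
  also have "\<dots> \<le> norm (\<eta> - (4 ^ j * a) *\<^sub>R axis \<dd> 1)"
    by (rule component_le_norm_cart)
  also have "\<dots> \<le> \<rho> * 2 ^ j"
    using \<eta> by (simp add: dist_norm norm_minus_commute)
  finally show ?thesis .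
qed

lemma norm_bounds: "4 ^ j / 32 \<le> norm \<eta>" "norm \<eta> \<le> 4 ^ j"
proof -
  show "4 ^ j / 32 \<le> norm \<eta>"
    using comp_dd_bounds(1) component_le_norm_cart[of \<eta> \<dd>] by linarith
  have "norm \<eta> \<le> norm ((4 ^ j * a) *\<^sub>R (axis \<dd> 1 :: real^'n)) + norm (\<eta> - (4 ^ j * a) *\<^sub>R axis \<dd> 1)"
    by (rule norm_triangle_sub)
  also have "\<dots> \<le> 4 ^ j * a + \<rho> * 2 ^ j"
    using \<eta> a by (simp add: dist_norm norm_minus_commute norm_axis_1)
  also have "\<dots> \<le> 4 ^ j * (1 / 2) + (1 / 128) * 4 ^ j"
    using a \<rho> by (intro add_mono mult_mono power_mono) auto
  also have "\<dots> \<le> 4 ^ j"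
    by simp
  finally show "norm \<eta> \<le> 4 ^ j" .
qed

lemma ratio_bound: "i \<noteq> \<dd> \<Longrightarrow> \<bar>2 ^ j * \<eta> $ i / \<eta> $ \<dd>\<bar> \<le> 32 * \<rho>"
proof -
  assume i: "i \<noteq> \<dd>"
  have pos: "\<eta> $ \<dd> > 0"
    using comp_dd_bounds(1) by (rule less_le_trans[rotated]) simp
  have "2 ^ j * \<bar>\<eta> $ i\<bar> \<le> 2 ^ j * (\<rho> * 2 ^ j)"
    using comp_other[OF i] by (intro mult_left_mono) auto
  also have "\<dots> = \<rho> * 4 ^ j"
    using power_mult_distrib[of "2::real" 2 j] by simp
  also have "\<dots> \<le> \<rho> * (32 * \<eta> $ \<dd>)"
    using comp_dd_bounds(1) \<rho> by (intro mult_left_mono) auto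
  finally show ?thesis
    using pos by (simp add: abs_mult abs_divide pos_divide_le_eq mult_ac)
qed

text \<open>The support of \<open>h1\<close> forces |\<eta>_e| to be comparable to 4^k. For another
  axis e, the support of \<open>h2\<close> and |l_\<dd>| \<le> 2^k would give |\<eta>_\<dd>| \<le> 2
  |\<eta>_e|, impossible so close to the axis \<dd>. On the right axis, comparing 4^k with 4^j fixes
  the scale, and the nearly zero slopes fix the shear.\<close>

lemma shear_freq:
  fixes h1 h2 :: "real \<Rightarrow> complex"
  assumes h1: "\<And>t. h1 t \<noteq> 0 \<Longrightarrow> 1 / 16 \<le> \<bar>t\<bar> \<and> \<bar>t\<bar> \<le> 1 / 2" and h2: "\<And>t. h2 t \<noteq> 0 \<Longrightarrow> \<bar>t\<bar> \<le> 1"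
    and l: "l \<in> shears e k" and nz: "shearlet_hat h1 h2 e (\<eta> v* shear_mat e k l) \<noteq> 0"
  shows "e = \<dd>" "j \<le> k + 2" "k \<le> j + 2" "\<bar>l $ i\<bar> \<le> 2"
proof -
  have e: "4 ^ k / 16 \<le> \<bar>\<eta> $ e\<bar>" "\<bar>\<eta> $ e\<bar> \<le> 4 ^ k / 2"
    using h1[of "\<eta> $ e / 4 ^ k"] nz by (auto simp: shearlet_hat_shear_mat field_simps)
  have epos: "\<bar>\<eta> $ e\<bar> > 0"
    using e(1) by (rule less_le_trans[rotated]) simp
  have h2': "\<bar>2 ^ k * \<eta> $ i / \<eta> $ e - real_of_int (l $ i)\<bar> \<le> 1" if "i \<noteq> e" for i
  proof -
    let ?t = "(\<eta> $ i / 2 ^ k - real_of_int (l $ i) * (\<eta> $ e / 4 ^ k)) / (\<eta> $ e / 4 ^ k)"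
    have "h2 ?t \<noteq> 0"
      using nz that by (auto simp: shearlet_hat_shear_mat)
    moreover have "?t = 2 ^ k * \<eta> $ i / \<eta> $ e - real_of_int (l $ i)"
    proof -
      have "(4::real) ^ k = 2 ^ k * 2 ^ k"
        using power_mult_distrib[of "2::real" 2 k] by simp
      then show ?thesis
        using epos by (simp add: field_simps)
    qed
    ultimately show ?thesis
      using h2 by simp
  qed
  show "e = \<dd>"
  proof (rule ccontr)
    assume ne: "e \<noteq> \<dd>"
    have "\<bar>l $ \<dd>\<bar> \<le> 2 ^ k"
      using l ne by (auto simp: shears_def)
    then have "real_of_int \<bar>l $ \<dd>\<bar> \<le> real_of_int (2 ^ k)"
      by (simp only: of_int_le_iff)
    then have "\<bar>2 ^ k * \<eta> $ \<dd> / \<eta> $ e\<bar> \<le> 1 + 2 ^ k"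
      using h2'[of \<dd>] ne by simp
    also have "\<dots> \<le> 2 * 2 ^ k"
      by simp
    finally have "2 ^ k * \<bar>\<eta> $ \<dd>\<bar> \<le> 2 ^ k * (2 * \<bar>\<eta> $ e\<bar>)"
      using epos by (simp add: abs_mult abs_divide pos_divide_le_eq mult_ac)
    then have "\<bar>\<eta> $ \<dd>\<bar> \<le> 2 * \<bar>\<eta> $ e\<bar>"
      by simp
    also have "\<dots> \<le> 2 * (\<rho> * 2 ^ j)"
      using comp_other[OF ne] by simp
    also have "\<dots> \<le> 2 * (1 / 128 * 4 ^ j)"
      using \<rho> by (intro mult_left_mono mult_mono power_mono) auto
    also have "\<dots> < 4 ^ j / 32"
      by simp
    finally show False
      using comp_dd_bounds(1) by linarith
  qed
  then have e': "4 ^ k / 16 \<le> (4::real) ^ j" "(4::real) ^ j / 32 \<le> 4 ^ k / 2"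
    using e comp_dd_bounds by auto
  have le: "(4::real) ^ k \<le> 4 ^ (j + 2)" "(4::real) ^ j \<le> 4 ^ (k + 2)"
    using e' by (simp_all add: power_add)
  show k: "k \<le> j + 2"
    by (rule power_le_imp_le_exp[OF _ le(1)]) simp
  show "j \<le> k + 2"
    by (rule power_le_imp_le_exp[OF _ le(2)]) simp
  show "\<bar>l $ i\<bar> \<le> 2"
  proof (cases "i = \<dd>")
    case True
    then show ?thesis
      using l \<open>e = \<dd>\<close> by (simp add: shears_def)
  next
    case False
    \<comment> \<open>Replacing scale j by k multiplies the slope by at most 4, so 4 * 32 * \<rho>
      \<le> 1 is required; this is the origin of 1/128.\<close>
    have "(2::real) ^ k \<le> 2 ^ (j + 2)"
      using k by (intro power_increasing) auto
    from mult_right_mono[OF this, of "\<bar>\<eta> $ i / \<eta> $ \<dd>\<bar>"]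
    have "\<bar>2 ^ k * \<eta> $ i / \<eta> $ \<dd>\<bar> \<le> 4 * \<bar>2 ^ j * \<eta> $ i / \<eta> $ \<dd>\<bar>"
      by (simp add: abs_mult abs_divide power_add mult_ac)
    also have "\<dots> \<le> 1"
      using ratio_bound[OF False] \<rho> by linarith
    finally have "\<bar>2 ^ k * \<eta> $ i / \<eta> $ \<dd>\<bar> \<le> 1" .
    moreover have "\<bar>2 ^ k * \<eta> $ i / \<eta> $ \<dd> - real_of_int (l $ i)\<bar> \<le> 1"
      using h2'[of i] False \<open>e = \<dd>\<close> by simp
    ultimately have "\<bar>real_of_int (l $ i)\<bar> \<le> 2"
      by linarith
    then show ?thesis
      by linarith
  qed
qed

text \<open>The norm of \<eta> lies between 2^(2j) / 32 and 2^(2j), the annulus of index \<nu>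
  between 2^\<nu> / 2 and 2 * 2^\<nu>. The offsets 1 and 6 are the base-2 logarithms of 2 and
  64.\<close>

lemma dyadic_freq:
  assumes "1 / 2 \<le> norm (\<eta> v* diag_mat (\<lambda>i. 1 / 2 ^ \<nu>))" "norm (\<eta> v* diag_mat (\<lambda>i. 1 / 2 ^ \<nu>)) \<le> 2"
  shows "\<nu> \<le> 2 * j + 1" "2 * j \<le> \<nu> + 6"
proof -
  have "\<eta> v* diag_mat (\<lambda>i. 1 / 2 ^ \<nu>) = (1 / 2 ^ \<nu>) *\<^sub>R \<eta>"
    by (simp add: vec_eq_iff vector_diag_mat)
  then have "2 ^ \<nu> / 2 \<le> norm \<eta>" "norm \<eta> \<le> 2 * 2 ^ \<nu>"
    using assms by (simp_all add: field_simps)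
  then have "2 ^ \<nu> / 2 \<le> (4::real) ^ j" "(4::real) ^ j / 32 \<le> 2 * 2 ^ \<nu>"
    using norm_bounds by linarith+
  moreover have "(4::real) ^ j = 2 ^ (2 * j)"
    by (simp add: power_mult)
  ultimately have le: "(2::real) ^ \<nu> \<le> 2 ^ (2 * j + 1)" "(2::real) ^ (2 * j) \<le> 2 ^ (\<nu> + 6)"
    by (simp_all add: power_add)
  show "\<nu> \<le> 2 * j + 1"
    by (rule power_le_imp_le_exp[OF _ le(1)]) simp
  show "2 * j \<le> \<nu> + 6"
    by (rule power_le_imp_le_exp[OF _ le(2)]) simp
qed

end

text \<open>In the coordinates \<eta>_\<dd> / 4^j and 2^j \<eta>_i / \<eta>_\<dd> the transform is
  one function G, the same for all j. Continuity of G at (a, 0), the image of the packet centre,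
  gives a \<rho> that works at every scale.\<close>

lemma shearlet_hat_near:
  fixes h1 h2 :: "real \<Rightarrow> complex" and \<dd> :: "'n::finite"
  assumes cont: "continuous_on UNIV h1" "continuous_on UNIV h2"
    and a: "1 / 16 \<le> a" "a \<le> 1 / 2" and nz: "h1 a \<noteq> 0" "h2 (- real_of_int k) \<noteq> 0"
  obtains \<rho> w where "0 < \<rho>" "\<rho> \<le> 1 / 128" "w \<noteq> 0"
    "\<And>j (\<eta>::real^'n) l. \<eta> \<in> cball ((4 ^ j * a) *\<^sub>R axis \<dd> 1) (\<rho> * 2 ^ j) \<Longrightarrow>
       (\<And>i. i \<noteq> \<dd> \<Longrightarrow> l $ i = k) \<Longrightarrow>
       norm (shearlet_hat h1 h2 \<dd> (\<eta> v* shear_mat \<dd> j l) - w) \<le> norm w / 4"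
proof -
  define G where "G = (\<lambda>(t, s :: real^'n). h1 t * (\<Prod>i\<in>UNIV - {\<dd>}. h2 (s $ i - real_of_int k)))"
  define w where "w = G (a, 0)"
  have w: "w \<noteq> 0"
    using nz by (simp add: w_def G_def)
  have "continuous_on UNIV G"
    unfolding G_def case_prod_beta
    by (intro continuous_intros continuous_on_compose2[OF cont(1)] continuous_on_compose2[OF cont(2)]) auto
  then have "isCont G (a, 0)"
    by (simp add: continuous_on_eq_continuous_at)
  moreover have "norm w / 4 > 0"
    using w by simp
  ultimately obtain \<epsilon> where \<epsilon>: "\<epsilon> > 0" "\<And>y. dist y (a, 0) < \<epsilon> \<Longrightarrow> dist (G y) w < norm w / 4"
    unfolding continuous_at_eps_delta w_def by blast
  \<comment> \<open>The first coordinate deviates by at most \<rho> and the slope vector by at most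
    32 * CARD * \<rho>; the factor 2 gives the strict inequality.\<close>
  define \<rho> where "\<rho> = min (1 / 128) (\<epsilon> / (2 * (1 + 32 * CARD('n))))"
  have den: "2 * (1 + 32 * real CARD('n)) > 0"
    by (simp add: add_pos_nonneg)
  have \<rho>_le: "0 < \<rho>" "\<rho> \<le> 1 / 128" "\<rho> \<le> \<epsilon> / (2 * (1 + 32 * CARD('n)))"
    unfolding \<rho>_def using \<epsilon>(1) den by (simp_all only: min.cobounded1 min.cobounded2) simp
  show ?thesis
  proof (rule that[OF \<rho>_le(1,2) w])
    fix j l and \<eta> :: "real^'n"
    assume \<eta>: "\<eta> \<in> cball ((4 ^ j * a) *\<^sub>R axis \<dd> 1) (\<rho> * 2 ^ j)" and l: "\<And>i. i \<noteq> \<dd> \<Longrightarrow> l $ i = k"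
    interpret packet_freq \<dd> a \<rho> j \<eta>
      using a \<rho>_le \<eta> by unfold_locales
    define s :: "real^'n" where "s = (\<chi> i. if i = \<dd> then 0 else 2 ^ j * \<eta> $ i / \<eta> $ \<dd>)"
    have pos: "\<eta> $ \<dd> > 0"
      using comp_dd_bounds(1) by (rule less_le_trans[rotated]) simp
    have four: "(4::real) ^ j = 2 ^ j * 2 ^ j"
      using power_mult_distrib[of "2::real" 2 j] by simp
    have "shearlet_hat h1 h2 \<dd> (\<eta> v* shear_mat \<dd> j l) = G (\<eta> $ \<dd> / 4 ^ j, s)"
      unfolding shearlet_hat_shear_mat G_def s_def using l pos
      by (auto intro!: prod.cong arg_cong[where f=h2] simp: four field_simps)
    moreover have "dist (\<eta> $ \<dd> / 4 ^ j, s) (a, 0) < \<epsilon>"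
    proof -
      have "norm s \<le> (\<Sum>i\<in>(UNIV :: 'n set). 32 * \<rho>)"
        using ratio_bound \<rho>_le(1) by (intro order_trans[OF norm_le_l1_cart] sum_mono) (auto simp: s_def)
      then have "dist (\<eta> $ \<dd> / 4 ^ j, s) (a, 0) \<le> \<rho> + 32 * CARD('n) * \<rho>"
        using comp_dd sqrt_sum_squares_le_sum_abs[of "dist (\<eta> $ \<dd> / 4 ^ j) a" "dist s 0"]
        by (simp add: dist_Pair_Pair dist_real_def)
      also have "\<dots> = (1 + 32 * CARD('n)) * \<rho>"
        by (simp add: algebra_simps)
      also have "\<dots> \<le> \<epsilon> / 2"
        using \<rho>_le(3) den by (simp add: pos_le_divide_eq mult_ac)
      finally show ?thesis
        using \<epsilon>(1) by simp
    qed
    ultimately show "norm (shearlet_hat h1 h2 \<dd> (\<eta> v* shear_mat \<dd> j l) - w) \<le> norm w / 4"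
      using \<epsilon>(2) by (simp add: dist_norm less_imp_le)
  qed
qed

section \<open>Quasi-norms of wave packets\<close>

lemma enn_powr_root: "0 < r \<Longrightarrow> 0 \<le> c \<Longrightarrow> enn_powr (ennreal (c powr r)) (1 / r) = ennreal c"
  by (simp add: enn_powr_ennreal powr_powr)

lemma finite_int_box: "finite {l :: int^'n. \<forall>i. \<bar>l $ i\<bar> \<le> B}"
proof (rule finite_subset)
  show "{l :: int^'n. \<forall>i. \<bar>l $ i\<bar> \<le> B} \<subseteq> vec_lambda ` (PiE UNIV (\<lambda>_. {- B..B}))"
  proof
    fix l :: "int^'n" assume l: "l \<in> {l. \<forall>i. \<bar>l $ i\<bar> \<le> B}"
    show "l \<in> vec_lambda ` (PiE UNIV (\<lambda>_. {- B..B}))"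
    proof (rule image_eqI)
      show "l = vec_lambda (vec_nth l)"
        by simp
      have "- B \<le> l $ i \<and> l $ i \<le> B" for i
        using l by (simp add: abs_le_iff) (metis minus_le_iff)
      then show "vec_nth l \<in> PiE UNIV (\<lambda>_. {- B..B})"
        by auto
    qed
  qed
qed (intro finite_imageI finite_PiE; simp)

lemma finite_shears: "finite (shears \<dd> j)"
proof (rule finite_subset[OF _ finite_int_box[of "2 ^ j"]])
  show "shears \<dd> j \<subseteq> {l. \<forall>i. \<bar>l $ i\<bar> \<le> 2 ^ j}"
    unfolding shears_def by (auto; case_tac "i = \<dd>"; simp)
qed

text \<open>At most 5 scales, a fixed finite set of shears and finitely many axes contribute, so the
  number of nonzero terms is bounded independently of j and q only affects the constant.\<close>

lemma shear_sum_le: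
  assumes q: "0 < q"
  obtains K where "K > 0" "\<And>j (a :: 'n::finite \<Rightarrow> nat \<Rightarrow> int^'n \<Rightarrow> ennreal) C. C \<ge> 0 \<Longrightarrow>
    (\<And>e k l. l \<in> shears e k \<Longrightarrow> a e k l \<le> ennreal C) \<Longrightarrow>
    (\<And>e k l i. l \<in> shears e k \<Longrightarrow> a e k l \<noteq> 0 \<Longrightarrow> j \<le> k + 2 \<and> k \<le> j + 2 \<and> \<bar>l $ i\<bar> \<le> 2) \<Longrightarrow>
    (if q = \<infinity> then (SUP e. SUP k. SUP l\<in>shears e k. a e k l)
     else enn_powr (\<Sum>e\<in>UNIV. \<Sum>k. \<Sum>l\<in>shears e k. enn_powr (a e k l) (enn2real q)) (1 / enn2real q))
    \<le> ennreal (K * C)"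
proof (cases "q = \<infinity>")
  case True
  then show ?thesis
    by (intro that[of 1]) (auto intro!: SUP_least)
next
  case False
  define r where "r = enn2real q"
  have r: "r > 0"
    using q False by (simp add: r_def enn2real_pos)
  define T where "T = {l :: int^'n. \<forall>i. \<bar>l $ i\<bar> \<le> 2}"
  have T: "finite T"
    unfolding T_def by (rule finite_int_box)
  define K where "K = real (CARD('n) * (5 * card T))"
  have "(0 :: int^'n) \<in> T"
    by (simp add: T_def)
  then have "card T > 0"
    using T card_gt_0_iff by blast
  then have "K > 0"
    by (simp add: K_def)
  show ?thesis
  proof (rule that[of "K powr (1 / r)"])
    show "K powr (1 / r) > 0"
      using \<open>K > 0\<close> by simp
    fix j C and a :: "'n \<Rightarrow> nat \<Rightarrow> int^'n \<Rightarrow> ennreal"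
    assume C: "C \<ge> 0" and le: "\<And>e k l. l \<in> shears e k \<Longrightarrow> a e k l \<le> ennreal C"
      and nz: "\<And>e k l i. l \<in> shears e k \<Longrightarrow> a e k l \<noteq> 0 \<Longrightarrow> j \<le> k + 2 \<and> k \<le> j + 2 \<and> \<bar>l $ i\<bar> \<le> 2"
    have zero: "(\<Sum>l\<in>shears e k. enn_powr (a e k l) r) = 0" if "k \<notin> {j - 2..j + 2}" for e k
    proof (rule sum.neutral, rule ballI)
      fix l assume "l \<in> shears e k"
      then have "a e k l = 0"
        using nz that by fastforce
      then show "enn_powr (a e k l) r = 0"
        by simp
    qed
    have inner: "(\<Sum>l\<in>shears e k. enn_powr (a e k l) r) \<le> of_nat (card T) * ennreal (C powr r)" for e k
    proof -
      have "(\<Sum>l\<in>shears e k. enn_powr (a e k l) r) = (\<Sum>l\<in>shears e k \<inter> T. enn_powr (a e k l) r)"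
      proof (rule sum.mono_neutral_right[OF finite_shears])
        have "a e k l = 0" if "l \<in> shears e k - T" for l
          using nz[of l e k] that unfolding T_def by blast
        then show "\<forall>l\<in>shears e k - shears e k \<inter> T. enn_powr (a e k l) r = 0"
          by simp
      qed simp
      also have "\<dots> \<le> (\<Sum>l\<in>shears e k \<inter> T. ennreal (C powr r))"
      proof (rule sum_mono)
        fix l assume "l \<in> shears e k \<inter> T"
        then have "enn_powr (a e k l) r \<le> enn_powr (ennreal C) r"
          using le r by (intro enn_powr_mono) auto
        then show "enn_powr (a e k l) r \<le> ennreal (C powr r)"
          by (simp add: enn_powr_ennreal C)
      qed
      also have "\<dots> \<le> (\<Sum>l\<in>T. ennreal (C powr r))"
        using T by (intro sum_mono2) auto
      finally show ?thesis
        by simp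
    qed
    have "(\<Sum>k. \<Sum>l\<in>shears e k. enn_powr (a e k l) r) \<le> of_nat (5 * card T) * ennreal (C powr r)" for e
    proof -
      have "(\<Sum>k. \<Sum>l\<in>shears e k. enn_powr (a e k l) r)
          = (\<Sum>k\<in>{j - 2..j + 2}. \<Sum>l\<in>shears e k. enn_powr (a e k l) r)"
        by (intro suminf_finite zero) auto
      also have "\<dots> \<le> (\<Sum>k\<in>{j - 2..j + 2}. of_nat (card T) * ennreal (C powr r))"
        by (intro sum_mono inner)
      also have "\<dots> = of_nat (card {j - 2..j + 2}) * (of_nat (card T) * ennreal (C powr r))"
        by simp
      \<comment> \<open>Truncated subtraction can only shorten the range, hence the
        inequality.\<close>
      also have "\<dots> \<le> of_nat 5 * (of_nat (card T) * ennreal (C powr r))"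
        by (intro mult_right_mono of_nat_mono) auto
      finally show ?thesis
        by (simp add: mult.assoc)
    qed
    then have "(\<Sum>e\<in>UNIV. \<Sum>k. \<Sum>l\<in>shears e k. enn_powr (a e k l) r)
        \<le> (\<Sum>e\<in>(UNIV :: 'n set). of_nat (5 * card T) * ennreal (C powr r))"
      by (intro sum_mono)
    also have "\<dots> = ennreal (K * C powr r)"
      by (simp add: K_def ennreal_mult' ennreal_of_nat_eq_real_of_nat mult.assoc)
    finally have "enn_powr (\<Sum>e\<in>UNIV. \<Sum>k. \<Sum>l\<in>shears e k. enn_powr (a e k l) r) (1 / r)
        \<le> enn_powr (ennreal (K * C powr r)) (1 / r)"
      using r by (intro enn_powr_mono) auto
    also have "\<dots> = ennreal (K powr (1 / r) * C)"
      using \<open>K > 0\<close> C r by (simp add: enn_powr_ennreal powr_mult powr_powr)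
    finally show "(if q = \<infinity> then (SUP e. SUP k. SUP l\<in>shears e k. a e k l)
       else enn_powr (\<Sum>e\<in>UNIV. \<Sum>k. \<Sum>l\<in>shears e k. enn_powr (a e k l) (enn2real q)) (1 / enn2real q))
       \<le> ennreal (K powr (1 / r) * C)"
      using False by (simp add: r_def)
  qed
qed

lemma shear_sum_ge:
  fixes a :: "'n::finite \<Rightarrow> nat \<Rightarrow> int^'n \<Rightarrow> ennreal"
  assumes q: "0 < q" and c: "c \<ge> 0" and l: "l \<in> shears e k" and ge: "ennreal c \<le> a e k l"
  shows "ennreal c \<le> (if q = \<infinity> then (SUP e. SUP k. SUP l\<in>shears e k. a e k l)
     else enn_powr (\<Sum>e\<in>UNIV. \<Sum>k. \<Sum>l\<in>shears e k. enn_powr (a e k l) (enn2real q)) (1 / enn2real q))"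
proof (cases "q = \<infinity>")
  case True
  have "a e k l \<le> (SUP e. SUP k. SUP l\<in>shears e k. a e k l)"
    using l by (intro SUP_upper2[of e] SUP_upper2[of k] SUP_upper) auto
  with ge True show ?thesis
    by (auto intro: order_trans)
next
  case False
  define r where "r = enn2real q"
  have r: "r > 0"
    using q False by (simp add: r_def enn2real_pos)
  have "ennreal (c powr r) \<le> enn_powr (a e k l) r"
    using enn_powr_mono[OF ge, of r] r c by (simp add: enn_powr_ennreal)
  also have "\<dots> \<le> (\<Sum>l\<in>shears e k. enn_powr (a e k l) r)"
    by (rule member_le_sum[OF l]) (auto intro: finite_shears)
  also have "\<dots> \<le> (\<Sum>k. \<Sum>l\<in>shears e k. enn_powr (a e k l) r)"
    using sum_le_suminf[OF summableI, of "{k}" "\<lambda>k. \<Sum>l\<in>shears e k. enn_powr (a e k l) r"] by simp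
  also have "\<dots> \<le> (\<Sum>e\<in>UNIV. \<Sum>k. \<Sum>l\<in>shears e k. enn_powr (a e k l) r)"
    by (rule member_le_sum) auto
  finally have "enn_powr (ennreal (c powr r)) (1 / r)
      \<le> enn_powr (\<Sum>e\<in>UNIV. \<Sum>k. \<Sum>l\<in>shears e k. enn_powr (a e k l) r) (1 / r)"
    using r by (intro enn_powr_mono) auto
  then show ?thesis
    using False r c by (simp add: enn_powr_root r_def)
qed

text \<open>The indices from 2j - 6 to 2j + 1 are at most 8 in number, fewer when the subtraction
  truncates.\<close>

lemma dyadic_sum_le:
  assumes q: "0 < q"
  obtains K where "K > 0" "\<And>j (a :: nat \<Rightarrow> ennreal) C. C \<ge> 0 \<Longrightarrow> (\<And>\<nu>. a \<nu> \<le> ennreal C) \<Longrightarrow>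
    (\<And>\<nu>. a \<nu> \<noteq> 0 \<Longrightarrow> \<nu> \<le> 2 * j + 1 \<and> 2 * j \<le> \<nu> + 6) \<Longrightarrow>
    (if q = \<infinity> then (SUP \<nu>. a \<nu>) else enn_powr (\<Sum>\<nu>. enn_powr (a \<nu>) (enn2real q)) (1 / enn2real q))
    \<le> ennreal (K * C)"
proof (cases "q = \<infinity>")
  case True
  then show ?thesis
    by (intro that[of 1]) (auto intro!: SUP_least)
next
  case False
  define r where "r = enn2real q"
  have r: "r > 0"
    using q False by (simp add: r_def enn2real_pos)
  show ?thesis
  proof (rule that[of "8 powr (1 / r)"])
    show "8 powr (1 / r) > (0::real)"
      by simp
    fix j C and a :: "nat \<Rightarrow> ennreal"
    assume C: "C \<ge> 0" and le: "\<And>\<nu>. a \<nu> \<le> ennreal C"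
      and nz: "\<And>\<nu>. a \<nu> \<noteq> 0 \<Longrightarrow> \<nu> \<le> 2 * j + 1 \<and> 2 * j \<le> \<nu> + 6"
    have zero: "enn_powr (a \<nu>) r = 0" if "\<nu> \<notin> {2 * j - 6..2 * j + 1}" for \<nu>
    proof -
      have "a \<nu> = 0"
        using nz[of \<nu>] that by fastforce
      then show ?thesis
        by simp
    qed
    have "(\<Sum>\<nu>. enn_powr (a \<nu>) r) = (\<Sum>\<nu>\<in>{2 * j - 6..2 * j + 1}. enn_powr (a \<nu>) r)"
      by (intro suminf_finite zero) auto
    also have "\<dots> \<le> (\<Sum>\<nu>\<in>{2 * j - 6..2 * j + 1}. enn_powr (ennreal C) r)"
      using le r by (intro sum_mono enn_powr_mono) auto
    also have "\<dots> = of_nat (card {2 * j - 6..2 * j + 1}) * ennreal (C powr r)"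
      using C by (simp add: enn_powr_ennreal)
    also have "\<dots> \<le> of_nat 8 * ennreal (C powr r)"
      by (intro mult_right_mono of_nat_mono) auto
    also have "\<dots> = ennreal (8 * C powr r)"
      by (simp add: ennreal_mult')
    finally have "enn_powr (\<Sum>\<nu>. enn_powr (a \<nu>) r) (1 / r) \<le> enn_powr (ennreal (8 * C powr r)) (1 / r)"
      using r by (intro enn_powr_mono) auto
    also have "\<dots> = ennreal (8 powr (1 / r) * C)"
      using C r by (simp add: enn_powr_ennreal powr_mult powr_powr)
    finally show "(if q = \<infinity> then (SUP \<nu>. a \<nu>) else enn_powr (\<Sum>\<nu>. enn_powr (a \<nu>) (enn2real q)) (1 / enn2real q))
      \<le> ennreal (8 powr (1 / r) * C)"
      using False by (simp add: r_def)
  qed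
qed

theorem theorem7p4:
  fixes \<Phi> \<phi> \<Psi> :: "real^'n \<Rightarrow> complex" and \<psi> :: "'n \<Rightarrow> real^'n \<Rightarrow> complex"
    and h1 h2 :: "real \<Rightarrow> complex"
    and d :: nat and \<alpha>1 \<alpha>2 :: real and p1 p2 q1 q2 :: ennreal
  assumes "d = CARD('n)" and "d \<ge> 2"
    and "dyadic_generators \<Phi> \<phi>"
    and "shearlet_system h1 h2 \<Psi> \<psi>"
    and "0 < p1" and "0 < p2" and "0 < q1" and "0 < q2"
    and "2 * \<alpha>1 + 3 / 2 * real d
           < (real d + 1) * (\<alpha>2 - real d * enn2real (1 / p2) / (real d + 1) + 1 / 2)
               + 1 / 2 + real d * enn2real (1 / p1)"
  shows "\<exists>f :: nat \<Rightarrow> real^'n \<Rightarrow> complex.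
           (\<forall>j. tempered_function (f j) \<and>
                distr_of (f j) \<in> shear_besov_space \<Psi> \<psi> \<alpha>2 p2 q2) \<and>
           (\<exists>c C :: real. 0 < c \<and> 0 < C \<and>
              (\<forall>j. ennreal c \<le> shear_besov_norm \<Psi> \<psi> \<alpha>2 p2 q2 (distr_of (f j)) \<and>
                   shear_besov_norm \<Psi> \<psi> \<alpha>2 p2 q2 (distr_of (f j)) \<le> ennreal C)) \<and>
           (\<lambda>j. besov_norm \<Phi> \<phi> \<alpha>1 p1 q1 (distr_of (f j))) \<longlonglongrightarrow> 0"
proof -

  \<comment> \<open>Supports of the generators and parameters of the packets\<close>
  note dyadic = assms(3)[unfolded dyadic_generators_def] and system = assms(4)[unfolded shearlet_system_def]
  note profiles = system[THEN conjunct1, unfolded shearlet_profiles_def]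
  \<comment> \<open>Any coordinate axis will do.\<close>
  define \<dd> :: 'n where "\<dd> = undefined"
  define E where "E p = real CARD('n) * enn2real (1 / p)" for p :: ennreal
  have \<phi>: "schwartz \<phi>" and \<Phi>: "schwartz \<Phi>" and \<Psi>: "schwartz \<Psi>" and \<psi>: "\<And>e. schwartz (\<psi> e)"
    and hat: "\<And>e. fourier (\<psi> e) = shearlet_hat h1 h2 e"
    using dyadic system by auto
  have h1: "1 / 16 \<le> \<bar>t\<bar> \<and> \<bar>t\<bar> \<le> 1 / 2" if "h1 t \<noteq> 0" for t
  proof -
    have "supp h1 \<subseteq> {- 1 / 2 .. - 1 / 16} \<union> {1 / 16 .. 1 / 2}"
      using profiles by blast
    then have "t \<in> {- 1 / 2 .. - 1 / 16} \<union> {1 / 16 .. 1 / 2}"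
      using in_supp[of h1 t] that by blast
    then show ?thesis
      by auto
  qed
  have h2: "\<bar>t\<bar> \<le> 1" if "h2 t \<noteq> 0" for t
  proof -
    have "supp h2 \<subseteq> {- 1 .. 1}"
      using profiles by blast
    then show ?thesis
      using in_supp[of h2 t] that by (auto simp: abs_le_iff)
  qed
  have \<Psi>_supp: "\<bar>\<eta> $ \<dd>\<bar> \<le> 1 / 4" if "fourier \<Psi> \<eta> \<noteq> 0" for \<eta>
    using system in_supp[of "fourier \<Psi>" \<eta>] that by blast
  have \<Phi>_supp: "norm \<eta> \<le> 2" if "fourier \<Phi> \<eta> \<noteq> 0" for \<eta>
    using dyadic in_supp[of "fourier \<Phi>" \<eta>] that by blast
  have \<phi>_supp: "1 / 2 \<le> norm \<eta> \<and> norm \<eta> \<le> 2" if "fourier \<phi> \<eta> \<noteq> 0" for \<eta>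
    using dyadic in_supp[of "fourier \<phi>" \<eta>] that by blast
  \<comment> \<open>The square-sum identity for \<open>h1\<close> at \<omega> = 1 forces a nonzero
    value at some 2^(-2j), and the support condition locates this positive point.\<close>
  obtain a where a: "1 / 16 \<le> a" "a \<le> 1 / 2" "h1 a \<noteq> 0"
  proof -
    have sums: "(\<lambda>j. (norm (h1 (1 / 2 ^ (2 * j))))\<^sup>2) sums 1"
      using profiles by (metis abs_one divide_le_eq_1_pos one_le_numeral zero_less_numeral)
    have "\<exists>j::nat. h1 (1 / 2 ^ (2 * j)) \<noteq> 0"
    proof (rule ccontr)
      assume "\<not> ?thesis"
      then have "(\<lambda>j::nat. 0::real) sums 1"
        using sums by simp
      from sums_unique2[OF this sums_zero] show False
        by simp
    qed
    then obtain j :: nat where j: "h1 (1 / 2 ^ (2 * j)) \<noteq> 0" ..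
    then show ?thesis
      using that[of "1 / 2 ^ (2 * j)"] h1[OF j] by auto
  qed
  \<comment> \<open>The identity for \<open>h2\<close> at \<omega> = 0 gives a nonzero value at -1,
    0 or 1. Taking every shear component equal to s moves the slope 0 of the packet to that
    point.\<close>
  obtain s :: int where s: "\<bar>s\<bar> \<le> 1" "h2 (- real_of_int s) \<noteq> 0"
  proof -
    have "(norm (h2 (0 - 1)))\<^sup>2 + (norm (h2 0))\<^sup>2 + (norm (h2 (0 + 1)))\<^sup>2 = 1"
      using profiles by (metis abs_zero zero_le_one)
    then have "h2 (-1) \<noteq> 0 \<or> h2 0 \<noteq> 0 \<or> h2 1 \<noteq> 0"
      by auto
    then show ?thesis
      using that[of 1] that[of 0] that[of "-1"] by auto
  qed
  have cont: "continuous_on UNIV h1" "continuous_on UNIV h2"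
    using profiles smooth_imp_continuous_on by blast+
  obtain \<rho> w where \<rho>: "0 < \<rho>" "\<rho> \<le> 1 / 128" and w: "w \<noteq> 0"
    and near: "\<And>j (\<eta>::real^'n) l. \<eta> \<in> cball ((4 ^ j * a) *\<^sub>R axis \<dd> 1) (\<rho> * 2 ^ j) \<Longrightarrow>
       (\<And>i. i \<noteq> \<dd> \<Longrightarrow> l $ i = s) \<Longrightarrow>
       norm (shearlet_hat h1 h2 \<dd> (\<eta> v* shear_mat \<dd> j l) - w) \<le> norm w / 4"
    by (rule shearlet_hat_near[OF cont a(1,2,3) s(2), of \<dd>]) blast
  obtain m where m: "E p1 < real m" "E p2 < real m"
    using reals_Archimedean2[of "max (E p1) (E p2)"] by auto
  have "0 \<le> E p1"
    by (simp add: E_def)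
  with m have m0: "m > 0"
    by (cases m) auto
  \<comment> \<open>Makes the radius CARD * m * \<mu> j of the packet spectrum exactly \<rho> * 2 ^
    j.\<close>
  define \<delta> where "\<delta> = \<rho> / (CARD('n) * m)"
  have "1 \<le> CARD('n) * m"
    using m0 by (simp add: Suc_le_eq)
  then have den: "1 \<le> real (CARD('n) * m)"
    by (metis of_nat_1 of_nat_le_iff)
  then have "\<rho> \<le> real (CARD('n) * m)"
    using \<rho> by linarith
  with den have \<delta>: "0 < \<delta>" "\<delta> \<le> 1" "CARD('n) * m * \<delta> = \<rho>"
    unfolding \<delta>_def using \<rho> m0 by (simp_all only: divide_le_eq) simp_all
  define \<mu> where "\<mu> j = \<delta> * 2 ^ j" for j :: nat
  define \<xi> where "\<xi> j = (4 ^ j * a) *\<^sub>R (axis \<dd> 1 :: real^'n)" for j :: nat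
  \<comment> \<open>The first factor cancels the weight |Q_j|^(-\<alpha>2), the second the size
    \<mu>^(-d/p2) of the L^p2 quasi-norm.\<close>
  define c where "c j = 2 powr (- ((real d + 1) * j * \<alpha>2)) * \<mu> j powr E p2" for j :: nat
  define f where "f j = packet m (\<xi> j) (\<mu> j) (c j)" for j
  have \<mu>: "\<mu> j > 0" for j
    using \<delta> by (simp add: \<mu>_def)
  have c: "c j \<ge> 0" for j
    by (simp add: c_def)
  have radius: "CARD('n) * m * \<mu> j = \<rho> * 2 ^ j" for j
    using \<delta>(3) by (simp add: \<mu>_def)
  have freq: "packet_freq \<dd> a \<rho> j \<eta>" if "\<eta> \<in> cball (\<xi> j) (CARD('n) * m * \<mu> j)" for \<eta> j
    using that a \<rho> unfolding radius \<xi>_def by unfold_locales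
  have kernel: "dilated_kernel (diag_mat (\<lambda>i. 1 / 2 ^ \<nu>)) g (\<mu> j)" if "schwartz g"
    for \<nu> j and g :: "real^'n \<Rightarrow> complex"
    using that \<mu> by unfold_locales (simp_all add: scaling_diag_mat invertible_det_nz det_diag_mat)
  \<comment> \<open>From j = 4 on the spectrum lies beyond the supports of both low-pass transforms
    (1/4 in a coordinate, 2 in norm). The final sequence is shifted by 4 for this reason.\<close>
  have large: "8 \<le> (4::real) ^ j / 32" if "j \<ge> 4" for j
    using power_increasing[OF that, of "4::real"] by simp
  \<comment> \<open>Lets the undilated low-pass generators be treated as kernels dilated by the
    identity.\<close>
  have one: "\<eta> v* diag_mat (\<lambda>i. 1) = \<eta>" "mat_dilate (diag_mat (\<lambda>i. 1)) g = g"
    for \<eta> :: "real^'n" and g :: "real^'n \<Rightarrow> complex"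
    using dyadic_dilate_eq[of 0 g] by (simp_all add: vec_eq_iff vector_diag_mat dyadic_dilate_0)

  \<comment> \<open>Vanishing of the low-frequency terms\<close>
  have \<Psi>_zero: "Lp_norm p2 (conv_distr (distr_of (f j)) \<Psi>) = 0" if j: "j \<ge> 4" for j
  proof -
    have "fourier \<Psi> \<eta> = 0" if "\<eta> \<in> cball (\<xi> j) (CARD('n) * m * \<mu> j)" for \<eta>
      using packet_freq.comp_dd_bounds(1)[OF freq[OF that]] \<Psi>_supp[of \<eta>] large[OF j] by fastforce
    then show ?thesis
      using dilated_kernel.Lp_norm_conv_packet_zero[OF kernel[OF \<Psi>, of 0 j] assms(6)]
      by (simp add: f_def one)
  qed
  have \<Phi>_zero: "Lp_norm p1 (conv_distr (distr_of (f j)) \<Phi>) = 0" if j: "j \<ge> 4" for j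
  proof -
    have "fourier \<Phi> \<eta> = 0" if "\<eta> \<in> cball (\<xi> j) (CARD('n) * m * \<mu> j)" for \<eta>
      using packet_freq.norm_bounds(1)[OF freq[OF that]] \<Phi>_supp[of \<eta>] large[OF j] by fastforce
    then show ?thesis
      using dilated_kernel.Lp_norm_conv_packet_zero[OF kernel[OF \<Phi>, of 0 j] assms(5)]
      by (simp add: f_def one)
  qed
  have cancel: "C * c j * \<mu> j powr (- E p2) = C * 2 powr (- ((real d + 1) * j * \<alpha>2))" for C j
    using \<mu>[of j] by (simp add: c_def powr_minus)

  \<comment> \<open>Two-sided bound for the shear quasi-norm\<close>
  define A where "A j e k l = ennreal (Q_vol CARD('n) k powr (- \<alpha>2))
    * Lp_norm p2 (conv_distr (distr_of (f j)) (mat_dilate (shear_mat e k l) (\<psi> e)))" for j e k l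
  have Q: "Q_vol CARD('n) k powr (- \<alpha>2) = 2 powr ((real d + 1) * k * \<alpha>2)" for k
    using assms(1) by (simp add: Q_vol_def powr_powr algebra_simps)
  have shear_kernel: "dilated_kernel (shear_mat e k l) (\<psi> e) (\<mu> j)" for e k l j
    using \<psi> \<mu> by unfold_locales (simp_all add: scaling_shear_mat invertible_shear_mat)
  have A_zero: "A j e k l = 0"
    if l: "l \<in> shears e k" and far: "\<not> (e = \<dd> \<and> j \<le> k + 2 \<and> k \<le> j + 2 \<and> (\<forall>i. \<bar>l $ i\<bar> \<le> 2))" for j e k l
  proof -
    have "fourier (\<psi> e) (\<eta> v* shear_mat e k l) = 0" if "\<eta> \<in> cball (\<xi> j) (CARD('n) * m * \<mu> j)" for \<eta>
      using packet_freq.shear_freq[OF freq[OF that] h1 h2 l] far unfolding hat by blast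
    then show ?thesis
      using dilated_kernel.Lp_norm_conv_packet_zero[OF shear_kernel assms(6)] by (simp add: A_def f_def)
  qed
  \<comment> \<open>The factor 4 pays for \<mu> j \<le> 2^j \<le> 4 * 2^k when the shearlet scale k
    is within 2 of j.\<close>
  define \<kappa> where "\<kappa> = 4 * (real CARD('n) * (1 + 2 * CARD('n)))"
  obtain C1 where C1: "C1 > 0" "\<And>M \<xi> (\<mu>::real) (c::real). scaling M \<Longrightarrow> invertible M \<Longrightarrow> \<mu> > 0 \<Longrightarrow> c \<ge> 0 \<Longrightarrow>
      (\<And>z. \<mu> * norm (M *v z) \<le> \<kappa> * norm z) \<Longrightarrow>
      Lp_norm p2 (conv_distr (distr_of (packet m \<xi> \<mu> c)) (mat_dilate M (\<psi> \<dd>))) \<le> ennreal (C1 * c * \<mu> powr (- E p2))"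
    using Lp_norm_conv_packet_le[OF assms(6) m(2)[unfolded E_def] \<psi>, of \<kappa> \<dd>] unfolding E_def \<kappa>_def
    by (metis (no_types, lifting) mult_nonneg_nonneg of_nat_0_le_iff zero_le_numeral add_nonneg_nonneg zero_le_one)
  \<comment> \<open>The power of 2 absorbs the mismatch between the weight at scale k and the
    normalisation at scale j, as |k - j| \<le> 2.\<close>
  define B where "B = C1 * 2 powr (2 * (real d + 1) * \<bar>\<alpha>2\<bar>)"
  have "B > 0"
    using C1 by (simp add: B_def)
  have A_le: "A j e k l \<le> ennreal B" if l: "l \<in> shears e k" for j e k l
  proof (cases "e = \<dd> \<and> j \<le> k + 2 \<and> k \<le> j + 2 \<and> (\<forall>i. \<bar>l $ i\<bar> \<le> 2)")
    case True
    then have [simp]: "e = \<dd>" and jk: "j \<le> k + 2" "k \<le> j + 2" and l2: "\<And>i. \<bar>l $ i\<bar> \<le> 2"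
      by auto
    have "\<mu> j * norm (shear_mat \<dd> k l *v z) \<le> \<kappa> * norm z" for z
    proof -
      have "\<mu> j \<le> 1 * 2 ^ (k + 2)"
        unfolding \<mu>_def using \<delta> jk by (intro mult_mono power_increasing) auto
      then have "\<mu> j * norm (shear_mat \<dd> k l *v z) \<le> 4 * (2 ^ k * norm (shear_mat \<dd> k l *v z))"
        using mult_right_mono[of "\<mu> j" "2 ^ (k + 2)" "norm (shear_mat \<dd> k l *v z)"] by (simp add: power_add)
      also have "\<dots> \<le> 4 * (CARD('n) * (1 + 2 * CARD('n)) * norm z)"
        by (intro mult_left_mono norm_shear_mat_le l2) simp
      finally show ?thesis
        by (simp add: \<kappa>_def algebra_simps)
    qed
    then have "Lp_norm p2 (conv_distr (distr_of (f j)) (mat_dilate (shear_mat \<dd> k l) (\<psi> \<dd>)))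
        \<le> ennreal (C1 * 2 powr (- ((real d + 1) * j * \<alpha>2)))"
      unfolding f_def cancel[symmetric] by (intro C1(2) scaling_shear_mat invertible_shear_mat \<mu> c)
    then have "A j e k l \<le> ennreal (2 powr ((real d + 1) * k * \<alpha>2)) * ennreal (C1 * 2 powr (- ((real d + 1) * j * \<alpha>2)))"
      unfolding A_def Q by (simp add: mult_left_mono)
    also have "\<dots> = ennreal (C1 * 2 powr ((real d + 1) * (real k - real j) * \<alpha>2))"
      using C1(1) by (simp add: algebra_simps flip: ennreal_mult' powr_add)
    also have "\<dots> \<le> ennreal B"
    proof -
      have "(real k - real j) * \<alpha>2 \<le> \<bar>real k - real j\<bar> * \<bar>\<alpha>2\<bar>"
        by (simp flip: abs_mult)
      also have "\<dots> \<le> 2 * \<bar>\<alpha>2\<bar>"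
        using jk by (intro mult_right_mono) auto
      finally have "(real d + 1) * ((real k - real j) * \<alpha>2) \<le> (real d + 1) * (2 * \<bar>\<alpha>2\<bar>)"
        by (intro mult_left_mono) auto
      then show ?thesis
        unfolding B_def using C1(1) by (intro ennreal_leI mult_left_mono powr_mono) (auto simp: mult_ac)
    qed
    finally show ?thesis .
  qed (simp add: A_zero[OF l])
  obtain C3 where C3: "C3 > 0" "\<And>M \<xi> (\<mu>::real) (c::real). scaling M \<Longrightarrow> invertible M \<Longrightarrow> \<mu> > 0 \<Longrightarrow> c \<ge> 0 \<Longrightarrow>
      (\<And>\<eta>. \<eta> \<in> cball \<xi> (CARD('n) * m * \<mu>) \<Longrightarrow> norm (fourier (\<psi> \<dd>) (\<eta> v* M) - w) \<le> norm w / 4) \<Longrightarrow>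
      ennreal (C3 * c * \<mu> powr (- E p2)) \<le> Lp_norm p2 (conv_distr (distr_of (packet m \<xi> \<mu> c)) (mat_dilate M (\<psi> \<dd>)))"
    using Lp_norm_conv_packet_ge[OF assms(6) \<psi> w, of m \<dd>] unfolding E_def by blast
  \<comment> \<open>The shear of the tile that sees the packet. It is admissible at every scale,
    since |s| \<le> 1 \<le> 2^j.\<close>
  define l0 :: "int^'n" where "l0 = (\<chi> i. if i = \<dd> then 0 else s)"
  have l0: "l0 \<in> shears \<dd> j" for j
    using s(1) by (auto simp: shears_def l0_def intro: order_trans)
  have A_ge: "ennreal C3 \<le> A j \<dd> j l0" for j
  proof -
    have "ennreal (C3 * 2 powr (- ((real d + 1) * j * \<alpha>2)))
        \<le> Lp_norm p2 (conv_distr (distr_of (f j)) (mat_dilate (shear_mat \<dd> j l0) (\<psi> \<dd>)))"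
      unfolding f_def cancel[symmetric]
    proof (intro C3(2) scaling_shear_mat invertible_shear_mat \<mu> c)
      fix \<eta> assume "\<eta> \<in> cball (\<xi> j) (CARD('n) * m * \<mu> j)"
      then show "norm (fourier (\<psi> \<dd>) (\<eta> v* shear_mat \<dd> j l0) - w) \<le> norm w / 4"
        unfolding radius hat \<xi>_def by (rule near) (simp add: l0_def)
    qed
    then have "ennreal (2 powr ((real d + 1) * j * \<alpha>2)) * ennreal (C3 * 2 powr (- ((real d + 1) * j * \<alpha>2))) \<le> A j \<dd> j l0"
      unfolding A_def Q by (rule mult_left_mono) simp
    moreover have "ennreal (2 powr x) * ennreal (C3 * 2 powr (- x)) = ennreal C3" for x
      by (simp add: powr_minus field_simps flip: ennreal_mult')
    ultimately show ?thesis
      by simp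
  qed
  obtain K where K: "K > 0" "\<And>j (a :: 'n \<Rightarrow> nat \<Rightarrow> int^'n \<Rightarrow> ennreal) C. C \<ge> 0 \<Longrightarrow>
    (\<And>e k l. l \<in> shears e k \<Longrightarrow> a e k l \<le> ennreal C) \<Longrightarrow>
    (\<And>e k l i. l \<in> shears e k \<Longrightarrow> a e k l \<noteq> 0 \<Longrightarrow> j \<le> k + 2 \<and> k \<le> j + 2 \<and> \<bar>l $ i\<bar> \<le> 2) \<Longrightarrow>
    (if q2 = \<infinity> then (SUP e. SUP k. SUP l\<in>shears e k. a e k l)
     else enn_powr (\<Sum>e\<in>UNIV. \<Sum>k. \<Sum>l\<in>shears e k. enn_powr (a e k l) (enn2real q2)) (1 / enn2real q2))
    \<le> ennreal (K * C)"
    by (rule shear_sum_le[OF assms(8)]) blast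
  have norm_eq: "shear_besov_norm \<Psi> \<psi> \<alpha>2 p2 q2 (distr_of (f j)) =
     (if q2 = \<infinity> then (SUP e. SUP k. SUP l\<in>shears e k. A j e k l)
     else enn_powr (\<Sum>e\<in>UNIV. \<Sum>k. \<Sum>l\<in>shears e k. enn_powr (A j e k l) (enn2real q2)) (1 / enn2real q2))"
    if "j \<ge> 4" for j
    unfolding shear_besov_norm_def Let_def A_def[symmetric] using \<Psi>_zero[OF that] by simp
  have upper: "shear_besov_norm \<Psi> \<psi> \<alpha>2 p2 q2 (distr_of (f j)) \<le> ennreal (K * B)" if "j \<ge> 4" for j
    unfolding norm_eq[OF that]
  proof (rule K(2)[where j=j])
    fix e k l i assume "l \<in> shears e k" "A j e k l \<noteq> 0"
    then show "j \<le> k + 2 \<and> k \<le> j + 2 \<and> \<bar>l $ i\<bar> \<le> 2"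
      using A_zero by blast
  qed (use A_le \<open>B > 0\<close> in auto)
  have lower: "ennreal C3 \<le> shear_besov_norm \<Psi> \<psi> \<alpha>2 p2 q2 (distr_of (f j))" if "j \<ge> 4" for j
    unfolding norm_eq[OF that] by (rule shear_sum_ge[where a="A j", OF assms(8) _ l0 A_ge]) (use C3 in simp)

  \<comment> \<open>Decay of the classical quasi-norm\<close>
  obtain C2 where C2: "C2 > 0" "\<And>M \<xi> (\<mu>::real) (c::real). scaling M \<Longrightarrow> invertible M \<Longrightarrow> \<mu> > 0 \<Longrightarrow> c \<ge> 0 \<Longrightarrow>
      (\<And>z. \<mu> * norm (M *v z) \<le> 64 * norm z) \<Longrightarrow>
      Lp_norm p1 (conv_distr (distr_of (packet m \<xi> \<mu> c)) (mat_dilate M \<phi>)) \<le> ennreal (C2 * c * \<mu> powr (- E p1))"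
    using Lp_norm_conv_packet_le[OF assms(5) m(1)[unfolded E_def] \<phi>, of 64] unfolding E_def by auto
  define a1 where "a1 j \<nu> = ennreal (2 powr (real \<nu> * \<alpha>1))
    * Lp_norm p1 (conv_distr (distr_of (f j)) (dyadic_dilate \<nu> \<phi>))" for j \<nu>
  have a1_zero: "a1 j \<nu> = 0" if far: "\<not> (\<nu> \<le> 2 * j + 1 \<and> 2 * j \<le> \<nu> + 6)" for j \<nu>
  proof -
    have "fourier \<phi> (\<eta> v* diag_mat (\<lambda>i. 1 / 2 ^ \<nu>)) = 0" if "\<eta> \<in> cball (\<xi> j) (CARD('n) * m * \<mu> j)" for \<eta>
      using packet_freq.dyadic_freq[OF freq[OF that], of \<nu>] \<phi>_supp far by blast
    then show ?thesis
      using dilated_kernel.Lp_norm_conv_packet_zero[OF kernel[OF \<phi>] assms(5)]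
      by (simp add: a1_def f_def dyadic_dilate_eq)
  qed
  define \<gamma> where "\<gamma> = 2 * \<alpha>1 - (real d + 1) * \<alpha>2 + E p2 - E p1"
  \<comment> \<open>Collecting the terms of the hypothesis gives \<gamma> < 1 - d, and d \<ge>
    2.\<close>
  have "\<gamma> < 0"
  proof -
    have "(real d + 1) * (\<alpha>2 - real d * enn2real (1 / p2) / (real d + 1) + 1 / 2)
        = (real d + 1) * \<alpha>2 - real d * enn2real (1 / p2) + (real d + 1) / 2"
      by (simp add: field_simps)
    moreover have "2 \<le> real d"
      using assms(2) by simp
    ultimately show ?thesis
      using assms(9) unfolding \<gamma>_def E_def assms(1)[symmetric] by argo
  qed
  \<comment> \<open>The power of \<delta> remains because \<mu> j is \<delta> * 2^j; the exponent 6
    |\<alpha>1| covers the deviation of \<nu> from 2j.\<close>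
  define H where "H = C2 * \<delta> powr (E p2 - E p1) * 2 powr (6 * \<bar>\<alpha>1\<bar>)"
  have "H > 0"
    using C2 \<delta> by (simp add: H_def)
  have a1_le: "a1 j \<nu> \<le> ennreal (H * 2 powr (j * \<gamma>))" for j \<nu>
  proof (cases "\<nu> \<le> 2 * j + 1 \<and> 2 * j \<le> \<nu> + 6")
    case True
    \<comment> \<open>Here 64 comes from j \<le> 2j \<le> \<nu> + 6, so that \<mu> j \<le> 2^j \<le>
      64 * 2^\<nu>.\<close>
    have "\<mu> j * norm (diag_mat (\<lambda>i. 1 / 2 ^ \<nu>) *v z) \<le> 64 * norm z" for z :: "real^'n"
    proof -
      have "diag_mat (\<lambda>i. 1 / 2 ^ \<nu>) *v z = (1 / 2 ^ \<nu>) *\<^sub>R z"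
        by (simp add: vec_eq_iff diag_mat_vector)
      moreover have "\<mu> j \<le> 1 * 2 ^ (\<nu> + 6)"
        unfolding \<mu>_def using \<delta> True by (intro mult_mono power_increasing) auto
      then have "\<mu> j / 2 ^ \<nu> \<le> 64"
        by (simp add: power_add field_simps)
      from mult_right_mono[OF this, of "norm z"] have "\<mu> j / 2 ^ \<nu> * norm z \<le> 64 * norm z"
        by simp
      ultimately show ?thesis
        by simp
    qed
    then have "Lp_norm p1 (conv_distr (distr_of (f j)) (dyadic_dilate \<nu> \<phi>)) \<le> ennreal (C2 * c j * \<mu> j powr (- E p1))"
      unfolding f_def dyadic_dilate_eq using kernel[OF \<phi>, of \<nu> j]
      by (intro C2(2) \<mu> c) (auto simp: dilated_kernel_def)
    then have "a1 j \<nu> \<le> ennreal (2 powr (real \<nu> * \<alpha>1)) * ennreal (C2 * c j * \<mu> j powr (- E p1))"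
      unfolding a1_def by (simp add: mult_left_mono)
    also have "\<dots> = ennreal (2 powr (real \<nu> * \<alpha>1) * (C2 * c j * \<mu> j powr (- E p1)))"
      by (simp add: ennreal_mult')
    also have "\<dots> \<le> ennreal (2 powr (2 * real j * \<alpha>1 + 6 * \<bar>\<alpha>1\<bar>) * (C2 * c j * \<mu> j powr (- E p1)))"
    proof -
      have "(real \<nu> - 2 * real j) * \<alpha>1 \<le> \<bar>real \<nu> - 2 * real j\<bar> * \<bar>\<alpha>1\<bar>"
        by (simp flip: abs_mult)
      also have "\<dots> \<le> 6 * \<bar>\<alpha>1\<bar>"
        using True by (intro mult_right_mono) auto
      finally have "real \<nu> * \<alpha>1 \<le> 2 * real j * \<alpha>1 + 6 * \<bar>\<alpha>1\<bar>"
        by (simp add: algebra_simps)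
      then show ?thesis
        using C2(1) c by (intro ennreal_leI mult_right_mono powr_mono) auto
    qed
    also have "2 powr (2 * real j * \<alpha>1 + 6 * \<bar>\<alpha>1\<bar>) * (C2 * c j * \<mu> j powr (- E p1)) = H * 2 powr (j * \<gamma>)"
    proof -
      have "\<mu> j powr E p2 * \<mu> j powr (- E p1) = \<delta> powr (E p2 - E p1) * 2 powr (j * (E p2 - E p1))"
      proof -
        have "\<mu> j powr E p2 * \<mu> j powr (- E p1) = \<mu> j powr (E p2 - E p1)"
          by (simp flip: powr_add)
        also have "\<dots> = \<delta> powr (E p2 - E p1) * (2 ^ j) powr (E p2 - E p1)"
          using \<delta> by (simp add: \<mu>_def powr_mult)
        also have "(2 ^ j) powr (E p2 - E p1) = 2 powr (j * (E p2 - E p1))"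
          by (simp add: powr_powr flip: powr_realpow)
        finally show ?thesis .
      qed
      note delta = this
      have two: "2 powr (2 * real j * \<alpha>1 + 6 * \<bar>\<alpha>1\<bar>) * 2 powr (- ((real d + 1) * j * \<alpha>2)) * 2 powr (j * (E p2 - E p1))
          = 2 powr (6 * \<bar>\<alpha>1\<bar>) * 2 powr (j * \<gamma>)"
        by (simp add: \<gamma>_def algebra_simps flip: powr_add)
      have "2 powr (2 * real j * \<alpha>1 + 6 * \<bar>\<alpha>1\<bar>) * (C2 * c j * \<mu> j powr (- E p1))
          = C2 * (2 powr (2 * real j * \<alpha>1 + 6 * \<bar>\<alpha>1\<bar>) * 2 powr (- ((real d + 1) * j * \<alpha>2)))
            * (\<mu> j powr E p2 * \<mu> j powr (- E p1))"
        by (simp add: c_def)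
      also have "\<dots> = C2 * \<delta> powr (E p2 - E p1) * (2 powr (2 * real j * \<alpha>1 + 6 * \<bar>\<alpha>1\<bar>)
            * 2 powr (- ((real d + 1) * j * \<alpha>2)) * 2 powr (j * (E p2 - E p1)))"
        unfolding delta by (simp only: mult_ac)
      also have "\<dots> = H * 2 powr (j * \<gamma>)"
        unfolding two H_def by (simp only: mult_ac)
      finally show ?thesis .
    qed
    finally show ?thesis .
  qed (simp add: a1_zero)
  obtain K1 where K1: "K1 > 0" "\<And>j (a :: nat \<Rightarrow> ennreal) C. C \<ge> 0 \<Longrightarrow> (\<And>\<nu>. a \<nu> \<le> ennreal C) \<Longrightarrow>
    (\<And>\<nu>. a \<nu> \<noteq> 0 \<Longrightarrow> \<nu> \<le> 2 * j + 1 \<and> 2 * j \<le> \<nu> + 6) \<Longrightarrow>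
    (if q1 = \<infinity> then (SUP \<nu>. a \<nu>) else enn_powr (\<Sum>\<nu>. enn_powr (a \<nu>) (enn2real q1)) (1 / enn2real q1))
    \<le> ennreal (K1 * C)"
    by (rule dyadic_sum_le[OF assms(7)]) blast
  have besov: "besov_norm \<Phi> \<phi> \<alpha>1 p1 q1 (distr_of (f j)) \<le> ennreal (K1 * (H * 2 powr (j * \<gamma>)))" if "j \<ge> 4" for j
    unfolding besov_norm_def Let_def a1_def[symmetric] \<Phi>_zero[OF that] add_0
    by (rule K1(2)[where j=j]) (use a1_le a1_zero \<open>H > 0\<close> in auto)

  \<comment> \<open>Passage to the limit and the shifted sequence\<close>
  have lim: "(\<lambda>j. ennreal (K1 * (H * 2 powr (real (j + 4) * \<gamma>)))) \<longlonglongrightarrow> 0"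
  proof -
    have "2 powr \<gamma> < (1::real)"
      using powr_less_mono[OF \<open>\<gamma> < 0\<close>, of 2] by simp
    then have "(\<lambda>j. (2 powr \<gamma>) ^ (j + 4)) \<longlonglongrightarrow> (0::real)"
      by (intro LIMSEQ_ignore_initial_segment LIMSEQ_realpow_zero) auto
    moreover have "(2 powr \<gamma>) ^ k = 2 powr (real k * \<gamma>)" for k
      by (simp add: powr_powr mult.commute flip: powr_realpow)
    ultimately have "(\<lambda>j. K1 * (H * 2 powr (real (j + 4) * \<gamma>))) \<longlonglongrightarrow> K1 * (H * 0)"
      by (intro tendsto_mult tendsto_const) simp
    then have "(\<lambda>j. ennreal (K1 * (H * 2 powr (real (j + 4) * \<gamma>)))) \<longlonglongrightarrow> ennreal (K1 * (H * 0))"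
      by (rule tendsto_ennrealI)
    then show ?thesis
      by simp
  qed
  have "tempered_function (f j)" "tempered_distribution (distr_of (f j))" for j
    by (simp_all add: f_def packet_tempered)
  moreover have "shear_besov_norm \<Psi> \<psi> \<alpha>2 p2 q2 (distr_of (f (j + 4))) < \<infinity>" for j
    using le_less_trans[OF upper[of "j + 4"] ennreal_less_top] by simp
  ultimately have "\<forall>j. tempered_function (f (j + 4)) \<and> distr_of (f (j + 4)) \<in> shear_besov_space \<Psi> \<psi> \<alpha>2 p2 q2"
    by (simp add: shear_besov_space_def)
  moreover have "0 < C3 \<and> 0 < K * B \<and>
      (\<forall>j. ennreal C3 \<le> shear_besov_norm \<Psi> \<psi> \<alpha>2 p2 q2 (distr_of (f (j + 4))) \<and>
           shear_besov_norm \<Psi> \<psi> \<alpha>2 p2 q2 (distr_of (f (j + 4))) \<le> ennreal (K * B))"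
    using C3(1) K(1) \<open>B > 0\<close> lower upper by simp
  moreover have "(\<lambda>j. besov_norm \<Phi> \<phi> \<alpha>1 p1 q1 (distr_of (f (j + 4)))) \<longlonglongrightarrow> 0"
  proof (rule tendsto_sandwich[OF _ _ tendsto_const lim])
    show "\<forall>\<^sub>F j in sequentially. besov_norm \<Phi> \<phi> \<alpha>1 p1 q1 (distr_of (f (j + 4)))
        \<le> ennreal (K1 * (H * 2 powr (real (j + 4) * \<gamma>)))"
      by (intro always_eventually allI besov) simp
  qed simp
  ultimately show ?thesis
    by (intro exI[of _ "\<lambda>j. f (j + 4)"] conjI) blast+
qed

end
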